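(* Let $(M,\mathcal A,L)$ be a Finsler space, let $a_{ij}$ be a pseudo-Riemannian metric on $M$, put $A=a_{ij}(x)y^iy^j$, and suppose $L=\Omega A$ on $\mathcal A$ for some $\Omega\in C^\infty(\mathcal A)$. Let $\mathring\Gamma^j_{ik}$ be the Levi-Civita Christoffel symbols of $a_{ij}$ and $\mathring\delta_i=\partial_i-\mathring\Gamma^j_{ik}(x)y^k\bar\partial_j$. Then: (i) $L$ is of Berwald type if and only if there exists a smooth tensor field $T^j{}_{ik}(x)$ of type $(1,2)$ on $M$, symmetric in its lower indices ($T^j{}_{ik}=T^j{}_{ki}$), such that on $\mathcal A$ $$A\,\mathring\delta_i\Omega=T^j{}_{ik}\,y^k\,\bar\partial_jL .$$ (ii) If so, the Christoffel symbols of the torsion-free affine connection compatible with $L$ are given by $$\Gamma^j_{ik}=\mathring\Gamma^j_{ik}+T^j{}_{ik},$$ and these $\Gamma^j_{ik}$ coincide with the horizontal Chern-Rund Christoffel symbols as well as with the horizontal Berwald Christoffel symbols of $L$.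
   Context: $M$ is a smooth manifold; coordinates $x^i$ on $M$ induce coordinates $(x^i,y^i)$ on $TM$; $\partial_i=\partial/\partial x^i$, $\bar\partial_i=\partial/\partial y^i$. A conic subbundle $\mathcal A\subset TM$ is an open subset with $\pi(\mathcal A)=M$ ($\pi:TM\to M$ the projection) such that $(x,y)\in\mathcal A$, $\lambda>0$ imply $(x,\lambda y)\in\mathcal A$. A Finsler Lagrangian on $\mathcal A$ is a smooth $L:\mathcal A\to\mathbb R$ with $L(x,\lambda y)=\lambda^2L(x,y)$ for all $\lambda>0$ and with $g_{ij}=\tfrac12\bar\partial_i\bar\partial_jL$ nondegenerate; $(M,\mathcal A,L)$ is then a Finsler space. Its canonical nonlinear connection has coefficients $N^j_i=\tfrac14\bar\partial_i\big[g^{jk}(y^m\partial_m\bar\partial_kL-\partial_kL)\big]$, with horizontal derivatives $\delta_i=\partial_i-N^j_i\bar\partial_j$. $L$ is of Berwald type if $N^k_i(x,y)=\Gamma^k_{ij}(x)y^j$ on $\mathcal A$ for some functions $\Gamma^k_{ij}$ of $x$ only; these are then the Christoffel symbols of the unique torsion-free affine connection on $M$ compatible with $L$ (compatible meaning $\partial_iL-\Gamma^j_{ik}y^k\bar\partial_jL=0$). The horizontal Chern-Rund Christoffel symbols are $\tfrac12g^{kl}(\delta_ig_{lj}+\delta_jg_{il}-\delta_lg_{ij})$ and the horizontal Berwald Christoffel symbols are $\bar\partial_jN^k_i$. *)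

theory Defs
  imports "HOL-Analysis.Analysis"
begin

section \<open>Partial derivatives and smooth maps between Euclidean spaces\<close>

definition dir_deriv ::
    "'a::real_normed_vector \<Rightarrow> ('a \<Rightarrow> 'b::real_normed_vector) \<Rightarrow> 'a \<Rightarrow> 'b"
  where "dir_deriv v f x = frechet_derivative f (at x) v"

abbreviation partial :: "'n::finite \<Rightarrow> (real^'n \<Rightarrow> real) \<Rightarrow> real^'n \<Rightarrow> real"
  where "partial i \<equiv> dir_deriv (axis i 1)"

primrec C_on ::
    "nat \<Rightarrow> ('a::euclidean_space \<Rightarrow> 'b::real_normed_vector) \<Rightarrow> 'a set \<Rightarrow> bool"
  where
    "C_on 0 f S \<longleftrightarrow> continuous_on S f"
  | "C_on (Suc k) f S \<longleftrightarrow>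
       (\<forall>x\<in>S. f differentiable (at x)) \<and> (\<forall>v. C_on k (dir_deriv v f) S)"

(* Only used for open S, where it is the usual notion of a C-infinity map. *)
definition smooth_on :: "('a::euclidean_space \<Rightarrow> 'b::real_normed_vector) \<Rightarrow> 'a set \<Rightarrow> bool"
  where "smooth_on f S \<longleftrightarrow> (\<forall>k. C_on k f S)"


section \<open>Smooth manifolds\<close>

type_synonym ('m, 'n) chart = "'m set \<times> ('m \<Rightarrow> real^'n)"

abbreviation chart_dom :: "('m, 'n::finite) chart \<Rightarrow> 'm set"
  where "chart_dom c \<equiv> fst c"

abbreviation coords :: "('m, 'n::finite) chart \<Rightarrow> 'm \<Rightarrow> real^'n"
  where "coords c \<equiv> snd c"

abbreviation chart_img :: "('m, 'n::finite) chart \<Rightarrow> (real^'n) set"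
  where "chart_img c \<equiv> coords c ` chart_dom c"

definition is_chart :: "'m topology \<Rightarrow> ('m, 'n::finite) chart \<Rightarrow> bool"
  where "is_chart X c \<longleftrightarrow>
    openin X (chart_dom c) \<and> open (chart_img c) \<and>
    homeomorphic_map (subtopology X (chart_dom c)) (top_of_set (chart_img c)) (coords c)"

(* The coordinates of c' as functions of the coordinates of c. *)
definition transition :: "('m, 'n::finite) chart \<Rightarrow> ('m, 'n) chart \<Rightarrow> real^'n \<Rightarrow> real^'n"
  where "transition c c' = coords c' \<circ> inv_into (chart_dom c) (coords c)"

definition overlap :: "('m, 'n::finite) chart \<Rightarrow> ('m, 'n) chart \<Rightarrow> 'm set"
  where "overlap c c' = chart_dom c \<inter> chart_dom c'"

(* The atlas need not be maximal; a maximal one is allowed. *)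
definition smooth_manifold :: "'m topology \<Rightarrow> ('m, 'n::finite) chart set \<Rightarrow> bool"
  where "smooth_manifold X atlas \<longleftrightarrow>
    Hausdorff_space X \<and> second_countable X \<and>
    (\<forall>c\<in>atlas. is_chart X c) \<and>
    (\<Union>c\<in>atlas. chart_dom c) = topspace X \<and>
    (\<forall>c\<in>atlas. \<forall>c'\<in>atlas. smooth_on (transition c c') (coords c ` overlap c c'))"

(* Entry (r, i) at x is the partial derivative of the r-th coordinate of c'
   with respect to the i-th coordinate of c. *)
definition jac :: "('m, 'n::finite) chart \<Rightarrow> ('m, 'n) chart \<Rightarrow> real^'n \<Rightarrow> real^'n^'n"
  where "jac c c' x = jacobian (transition c c') (at x)"


section \<open>The tangent bundle\<close>

(* A tangent vector at p is given by its components in all charts around p, which are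
   related by the Jacobians of the transition maps.  The value 0 at all other arguments
   makes the representation unique. *)
type_synonym ('m, 'n) tvec = "'m \<times> (('m, 'n) chart \<Rightarrow> real^'n)"

definition tangent_bundle :: "('m, 'n::finite) chart set \<Rightarrow> ('m, 'n) tvec set"
  where "tangent_bundle atlas = {(p, v).
    (\<exists>c\<in>atlas. p \<in> chart_dom c) \<and>
    (\<forall>c\<in>atlas. \<forall>c'\<in>atlas. p \<in> overlap c c' \<longrightarrow> v c' = jac c c' (coords c p) *v v c) \<and>
    (\<forall>c. \<not> (c \<in> atlas \<and> p \<in> chart_dom c) \<longrightarrow> v c = 0)}"

definition tscale :: "real \<Rightarrow> ('m, 'n::finite) tvec \<Rightarrow> ('m, 'n) tvec"
  where "tscale t \<xi> = (fst \<xi>, \<lambda>c. t *\<^sub>R snd \<xi> c)"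

(* The induced bundle coordinates (x, y). *)
definition tcoords :: "('m, 'n::finite) chart \<Rightarrow> ('m, 'n) tvec \<Rightarrow> (real^'n) \<times> (real^'n)"
  where "tcoords c \<xi> = (coords c (fst \<xi>), snd \<xi> c)"

definition over :: "('m, 'n::finite) tvec set \<Rightarrow> ('m, 'n) chart \<Rightarrow> ('m, 'n) tvec set"
  where "over \<A> c = {\<xi>\<in>\<A>. fst \<xi> \<in> chart_dom c}"

definition local_set :: "('m, 'n::finite) tvec set \<Rightarrow> ('m, 'n) chart \<Rightarrow> ((real^'n) \<times> (real^'n)) set"
  where "local_set \<A> c = tcoords c ` over \<A> c"

(* A function on the tangent bundle, written in the bundle coordinates of c. *)
definition local_rep :: "('m, 'n::finite) chart set \<Rightarrow> ('m, 'n) chart \<Rightarrow>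
    (('m, 'n) tvec \<Rightarrow> real) \<Rightarrow> (real^'n) \<times> (real^'n) \<Rightarrow> real"
  where "local_rep atlas c F = F \<circ> inv_into (over (tangent_bundle atlas) c) (tcoords c)"

definition topen :: "('m, 'n::finite) chart set \<Rightarrow> ('m, 'n) tvec set \<Rightarrow> bool"
  where "topen atlas \<A> \<longleftrightarrow>
    \<A> \<subseteq> tangent_bundle atlas \<and> (\<forall>c\<in>atlas. open (local_set \<A> c))"

definition tsmooth_on :: "('m, 'n::finite) chart set \<Rightarrow> ('m, 'n) tvec set \<Rightarrow>
    (('m, 'n) tvec \<Rightarrow> real) \<Rightarrow> bool"
  where "tsmooth_on atlas \<A> F \<longleftrightarrow>
    (\<forall>c\<in>atlas. smooth_on (local_rep atlas c F) (local_set \<A> c))"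

definition conic_subbundle ::
    "'m topology \<Rightarrow> ('m, 'n::finite) chart set \<Rightarrow> ('m, 'n) tvec set \<Rightarrow> bool"
  where "conic_subbundle X atlas \<A> \<longleftrightarrow>
    topen atlas \<A> \<and> fst ` \<A> = topspace X \<and>
    (\<forall>\<xi>\<in>\<A>. \<forall>t>0. tscale t \<xi> \<in> \<A>)"


section \<open>Tensor fields and affine connections on the base\<close>

(* Fields are given by components in every chart, as functions of the coordinates x of that
   chart, subject to the classical transformation laws.  For 3-index objects,
   component (j; i, k), with j the upper index, is written  T c x $ j $ i $ k. *)

type_synonym ('m, 'n) field2 = "('m, 'n) chart \<Rightarrow> real^'n \<Rightarrow> real^'n^'n"
type_synonym ('m, 'n) field3 = "('m, 'n) chart \<Rightarrow> real^'n \<Rightarrow> real^'n^'n^'n"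

definition pseudo_riemannian_metric ::
    "('m, 'n::finite) chart set \<Rightarrow> ('m, 'n) field2 \<Rightarrow> bool"
  where "pseudo_riemannian_metric atlas a \<longleftrightarrow>
    (\<forall>c\<in>atlas. smooth_on (a c) (chart_img c) \<and>
       (\<forall>x\<in>chart_img c. transpose (a c x) = a c x \<and> invertible (a c x))) \<and>
    (\<forall>c\<in>atlas. \<forall>c'\<in>atlas. \<forall>p\<in>overlap c c'. \<forall>r s.
       a c' (coords c' p) $ r $ s =
         (\<Sum>i\<in>UNIV. \<Sum>j\<in>UNIV. a c (coords c p) $ i $ j *
            jac c' c (coords c' p) $ i $ r * jac c' c (coords c' p) $ j $ s))"

definition smooth_tensor_1_2 :: "('m, 'n::finite) chart set \<Rightarrow> ('m, 'n) field3 \<Rightarrow> bool"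
  where "smooth_tensor_1_2 atlas T \<longleftrightarrow>
    (\<forall>c\<in>atlas. smooth_on (T c) (chart_img c)) \<and>
    (\<forall>c\<in>atlas. \<forall>c'\<in>atlas. \<forall>p\<in>overlap c c'. \<forall>r s t.
       T c' (coords c' p) $ r $ s $ t =
         (\<Sum>j\<in>UNIV. \<Sum>i\<in>UNIV. \<Sum>k\<in>UNIV.
            jac c c' (coords c p) $ r $ j * T c (coords c p) $ j $ i $ k *
            jac c' c (coords c' p) $ i $ s * jac c' c (coords c' p) $ k $ t))"

definition affine_connection :: "('m, 'n::finite) chart set \<Rightarrow> ('m, 'n) field3 \<Rightarrow> bool"
  where "affine_connection atlas \<Gamma> \<longleftrightarrow>
    (\<forall>c\<in>atlas. smooth_on (\<Gamma> c) (chart_img c)) \<and>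
    (\<forall>c\<in>atlas. \<forall>c'\<in>atlas. \<forall>p\<in>overlap c c'. \<forall>r s t.
       \<Gamma> c' (coords c' p) $ r $ s $ t =
         (\<Sum>j\<in>UNIV. \<Sum>i\<in>UNIV. \<Sum>k\<in>UNIV.
            jac c c' (coords c p) $ r $ j * \<Gamma> c (coords c p) $ j $ i $ k *
            jac c' c (coords c' p) $ i $ s * jac c' c (coords c' p) $ k $ t) +
         (\<Sum>j\<in>UNIV. jac c c' (coords c p) $ r $ j *
            partial s (partial t (\<lambda>x'. transition c' c x' $ j)) (coords c' p)))"

definition lower_symmetric :: "('m, 'n::finite) chart set \<Rightarrow> ('m, 'n) field3 \<Rightarrow> bool"
  where "lower_symmetric atlas T \<longleftrightarrow>
    (\<forall>c\<in>atlas. \<forall>x\<in>chart_img c. \<forall>j i k. T c x $ j $ i $ k = T c x $ j $ k $ i)"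

definition torsion_free_affine_connection ::
    "('m, 'n::finite) chart set \<Rightarrow> ('m, 'n) field3 \<Rightarrow> bool"
  where "torsion_free_affine_connection atlas \<Gamma> \<longleftrightarrow>
    affine_connection atlas \<Gamma> \<and> lower_symmetric atlas \<Gamma>"

definition levi_civita :: "('m, 'n::finite) field2 \<Rightarrow> ('m, 'n) field3"
  where "levi_civita a c x = (\<chi> j i k. 1/2 * (\<Sum>l\<in>UNIV. matrix_inv (a c x) $ j $ l *
    (partial i (\<lambda>x. a c x $ l $ k) x + partial k (\<lambda>x. a c x $ i $ l) x
       - partial l (\<lambda>x. a c x $ i $ k) x)))"

definition quad_form :: "real^'n^'n \<Rightarrow> real^'n \<Rightarrow> real"
  where "quad_form a y = (\<Sum>i\<in>UNIV. \<Sum>j\<in>UNIV. a $ i $ j * y $ i * y $ j)"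


section \<open>Finsler geometry in bundle coordinates\<close>

abbreviation partial_x ::
    "'n::finite \<Rightarrow> ((real^'n) \<times> (real^'n) \<Rightarrow> real) \<Rightarrow> (real^'n) \<times> (real^'n) \<Rightarrow> real"
  where "partial_x i \<equiv> dir_deriv (axis i 1, 0)"

abbreviation partial_y ::
    "'n::finite \<Rightarrow> ((real^'n) \<times> (real^'n) \<Rightarrow> real) \<Rightarrow> (real^'n) \<times> (real^'n) \<Rightarrow> real"
  where "partial_y i \<equiv> dir_deriv (0, axis i 1)"

definition fundamental_tensor ::
    "((real^'n::finite) \<times> (real^'n) \<Rightarrow> real) \<Rightarrow> (real^'n) \<times> (real^'n) \<Rightarrow> real^'n^'n"
  where "fundamental_tensor L z = (\<chi> i j. 1/2 * partial_y i (partial_y j L) z)"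

(* Arguments j i: upper index first, i.e. the coefficient with upper index j, lower index i. *)
definition canonical_N ::
    "((real^'n::finite) \<times> (real^'n) \<Rightarrow> real) \<Rightarrow> 'n \<Rightarrow> 'n \<Rightarrow> (real^'n) \<times> (real^'n) \<Rightarrow> real"
  where "canonical_N L j i = (\<lambda>z. 1/4 * partial_y i (\<lambda>w.
    \<Sum>k\<in>UNIV. matrix_inv (fundamental_tensor L w) $ j $ k *
      ((\<Sum>m\<in>UNIV. snd w $ m * partial_x m (partial_y k L) w) - partial_x k L w)) z)"

definition horizontal_deriv ::
    "('n::finite \<Rightarrow> 'n \<Rightarrow> (real^'n) \<times> (real^'n) \<Rightarrow> real) \<Rightarrow> 'n \<Rightarrow>
     ((real^'n) \<times> (real^'n) \<Rightarrow> real) \<Rightarrow> (real^'n) \<times> (real^'n) \<Rightarrow> real"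
  where "horizontal_deriv N i F z = partial_x i F z - (\<Sum>j\<in>UNIV. N j i z * partial_y j F z)"

definition linear_N ::
    "(real^'n \<Rightarrow> real^'n^'n^'n) \<Rightarrow> 'n::finite \<Rightarrow> 'n \<Rightarrow> (real^'n) \<times> (real^'n) \<Rightarrow> real"
  where "linear_N G j i z = (\<Sum>k\<in>UNIV. G (fst z) $ j $ i $ k * snd z $ k)"

(* Upper index k, lower indices i and j. *)
definition chern_rund ::
    "((real^'n::finite) \<times> (real^'n) \<Rightarrow> real) \<Rightarrow> 'n \<Rightarrow> 'n \<Rightarrow> 'n \<Rightarrow> (real^'n) \<times> (real^'n) \<Rightarrow> real"
  where "chern_rund L k i j z = 1/2 * (\<Sum>l\<in>UNIV.
    matrix_inv (fundamental_tensor L z) $ k $ l *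
      (horizontal_deriv (canonical_N L) i (\<lambda>w. fundamental_tensor L w $ l $ j) z
     + horizontal_deriv (canonical_N L) j (\<lambda>w. fundamental_tensor L w $ i $ l) z
     - horizontal_deriv (canonical_N L) l (\<lambda>w. fundamental_tensor L w $ i $ j) z))"

definition berwald_symbol ::
    "((real^'n::finite) \<times> (real^'n) \<Rightarrow> real) \<Rightarrow> 'n \<Rightarrow> 'n \<Rightarrow> 'n \<Rightarrow> (real^'n) \<times> (real^'n) \<Rightarrow> real"
  where "berwald_symbol L k i j = partial_y j (canonical_N L k i)"


section \<open>Finsler spaces\<close>

definition finsler_lagrangian ::
    "('m, 'n::finite) chart set \<Rightarrow> ('m, 'n) tvec set \<Rightarrow> (('m, 'n) tvec \<Rightarrow> real) \<Rightarrow> bool"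
  where "finsler_lagrangian atlas \<A> L \<longleftrightarrow>
    tsmooth_on atlas \<A> L \<and>
    (\<forall>\<xi>\<in>\<A>. \<forall>t>0. L (tscale t \<xi>) = t\<^sup>2 * L \<xi>) \<and>
    (\<forall>c\<in>atlas. \<forall>z\<in>local_set \<A> c. invertible (fundamental_tensor (local_rep atlas c L) z))"

definition finsler_space :: "'m topology \<Rightarrow> ('m, 'n::finite) chart set \<Rightarrow> ('m, 'n) tvec set \<Rightarrow>
    (('m, 'n) tvec \<Rightarrow> real) \<Rightarrow> bool"
  where "finsler_space X atlas \<A> L \<longleftrightarrow>
    smooth_manifold X atlas \<and> conic_subbundle X atlas \<A> \<and> finsler_lagrangian atlas \<A> L"

definition berwald_type ::
    "('m, 'n::finite) chart set \<Rightarrow> ('m, 'n) tvec set \<Rightarrow> (('m, 'n) tvec \<Rightarrow> real) \<Rightarrow> bool"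
  where "berwald_type atlas \<A> L \<longleftrightarrow>
    (\<forall>c\<in>atlas. \<exists>\<Gamma> :: real^'n \<Rightarrow> real^'n^'n^'n. \<forall>z\<in>local_set \<A> c. \<forall>k i.
       canonical_N (local_rep atlas c L) k i z =
         (\<Sum>j\<in>UNIV. \<Gamma> (fst z) $ k $ i $ j * snd z $ j))"

definition compatible :: "('m, 'n::finite) chart set \<Rightarrow> ('m, 'n) tvec set \<Rightarrow>
    (('m, 'n) tvec \<Rightarrow> real) \<Rightarrow> ('m, 'n) field3 \<Rightarrow> bool"
  where "compatible atlas \<A> L \<Gamma> \<longleftrightarrow>
    (\<forall>c\<in>atlas. \<forall>z\<in>local_set \<A> c. \<forall>i.
       horizontal_deriv (linear_N (\<Gamma> c)) i (local_rep atlas c L) z = 0)"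

definition deformation_equation :: "('m, 'n::finite) chart set \<Rightarrow> ('m, 'n) tvec set \<Rightarrow>
    (('m, 'n) tvec \<Rightarrow> real) \<Rightarrow> (('m, 'n) tvec \<Rightarrow> real) \<Rightarrow> ('m, 'n) field2 \<Rightarrow> ('m, 'n) field3 \<Rightarrow> bool"
  where "deformation_equation atlas \<A> L \<Omega> a T \<longleftrightarrow>
    (\<forall>c\<in>atlas. \<forall>z\<in>local_set \<A> c. \<forall>i.
       quad_form (a c (fst z)) (snd z) *
         horizontal_deriv (linear_N (levi_civita a c)) i (local_rep atlas c \<Omega>) z =
       (\<Sum>j\<in>UNIV. \<Sum>k\<in>UNIV. T c (fst z) $ j $ i $ k * snd z $ k *
          partial_y j (local_rep atlas c L) z))"

end

theory Submission
  imports Defs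
begin

text \<open>In a chart, suppose that symbols \<open>G\<close> at a point \<open>x\<close>, symmetric in the lower indices, are
  compatible with \<open>L\<close> on the whole fibre over \<open>x\<close>.  Differentiating the compatibility identity in
  \<open>y\<close> shows that the spray of \<open>L\<close> is \<open>2 G\<^sup>j\<^sub>m\<^sub>k y\<^sup>m y\<^sup>k\<close>, so the canonical nonlinear connection is
  \<open>G y\<close>.  This identifies \<open>G\<close> with the Berwald and Chern-Rund symbols, and in particular makes it
  unique.  Conversely, Euler's theorem gives \<open>\<delta>\<^sub>i L = 0\<close> for the canonical nonlinear connection, so
  its coefficients are symmetric and compatible symbols if they are linear in \<open>y\<close>.  Hence \<open>L\<close> is
  of Berwald type iff it admits symmetric compatible symbols.  The same applies to the quadratic
  form \<open>A\<close> and its Levi-Civita symbols, and \<open>\<delta>\<close>-differentiating \<open>L = \<Omega> A\<close> turns compatibility of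
  Levi-Civita plus \<open>T\<close> into the deformation equation.\<close>

section \<open>Directional derivatives\<close>

text \<open>\<open>berwald_type\<close> supplies in each chart a bare array of functions, with no
  smoothness, no symmetry and no relation to the arrays of other charts, while \<open>T\<close> has
  to be a smooth symmetric tensor. Smoothness is found upstairs: the Berwald symbols are smooth on
  an open part of the tangent bundle and, once independent of \<open>y\<close>, descend along the
  projection, which is open and has local sections. The behaviour under coordinate changes is found
  from below: compatibility equates first derivatives of one scalar function, so the ordinary chain
  rule transports it. For both purposes the argument runs over a single base point, where the
  symbols are a constant array. The metric \<open>a\<close> may be indefinite, so \<open>A\<close>
  can vanish on nonzero vectors and \<Omega> cannot be treated as \<open>L / A\<close>. Nothing is
  divided by \<open>A\<close>: as \<open>A\<close> is constant along the Levi-Civita horizontal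
  derivatives, the Leibniz rule gives \<open>A\<close> times the derivative of \<Omega> directly, on
  null vectors as elsewhere.\<close>

lemma dir_deriv_eq:
  assumes "(f has_derivative f') (at x)"
  shows "dir_deriv v f x = f' v"
  using frechet_derivative_at[OF assms] by (simp add: dir_deriv_def)

lemma has_derivative_dir_deriv:
  assumes "f differentiable (at x)"
  shows "(f has_derivative (\<lambda>v. dir_deriv v f x)) (at x)"
  using assms by (simp add: dir_deriv_def frechet_derivative_works[symmetric])

lemma linear_dir_deriv:
  assumes "f differentiable (at x)"
  shows "linear (\<lambda>v. dir_deriv v f x)"
  using has_derivative_dir_deriv[OF assms] has_derivative_linear by blast

lemma dir_deriv_zero: "f differentiable (at x) \<Longrightarrow> dir_deriv 0 f x = 0"
  by (rule linear_0[OF linear_dir_deriv])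

text \<open>\<open>frechet_derivative\<close> is a choice among all derivatives at the point, and
  \<open>f\<close> and \<open>g\<close> have the same ones; the two sides agree even where no
  derivative exists.\<close>

lemma dir_deriv_cong_open:
  assumes "open S" "x \<in> S" "\<And>y. y \<in> S \<Longrightarrow> f y = g y"
  shows "dir_deriv v f x = dir_deriv v g x"
proof -
  have "(f has_derivative D) (at x) \<longleftrightarrow> (g has_derivative D) (at x)" for D
    using assms by (metis has_derivative_transform_within_open)
  then show ?thesis
    by (simp add: dir_deriv_def frechet_derivative_def)
qed

lemma differentiable_cong_open:
  assumes "open S" "x \<in> S" "\<And>y. y \<in> S \<Longrightarrow> f y = g y" "f differentiable (at x)"
  shows "g differentiable (at x)"
  using assms unfolding differentiable_def by (metis has_derivative_transform_within_open)

lemma dir_deriv_const [simp]: "dir_deriv v (\<lambda>x. c) x = 0"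
  by (simp add: dir_deriv_def)

lemma dir_deriv_bounded_linear:
  "bounded_linear h \<Longrightarrow> dir_deriv v h x = h v"
  by (rule dir_deriv_eq) (rule bounded_linear_imp_has_derivative)

lemma dir_deriv_add:
  assumes "f differentiable (at x)" "g differentiable (at x)"
  shows "dir_deriv v (\<lambda>x. f x + g x) x = dir_deriv v f x + dir_deriv v g x"
  by (rule dir_deriv_eq[OF has_derivative_add[OF assms[THEN has_derivative_dir_deriv]]])

lemma dir_deriv_sum:
  assumes "\<And>i. i \<in> I \<Longrightarrow> f i differentiable (at x)"
  shows "dir_deriv v (\<lambda>x. \<Sum>i\<in>I. f i x) x = (\<Sum>i\<in>I. dir_deriv v (f i) x)"
  by (rule dir_deriv_eq[OF has_derivative_sum]) (rule has_derivative_dir_deriv[OF assms])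

lemma dir_deriv_mult:
  fixes f g :: "'a::real_normed_vector \<Rightarrow> real"
  assumes "f differentiable (at x)" "g differentiable (at x)"
  shows "dir_deriv v (\<lambda>x. f x * g x) x = dir_deriv v f x * g x + f x * dir_deriv v g x"
  using dir_deriv_eq[OF has_derivative_mult[OF assms[THEN has_derivative_dir_deriv]]]
  by (simp add: add.commute)

lemma dir_deriv_cmult:
  fixes f :: "'a::real_normed_vector \<Rightarrow> real"
  assumes "f differentiable (at x)"
  shows "dir_deriv v (\<lambda>x. c * f x) x = c * dir_deriv v f x"
  using dir_deriv_mult[OF differentiable_const assms] by simp

lemma dir_deriv_inverse:
  fixes f :: "'a::real_normed_vector \<Rightarrow> real"
  assumes "f differentiable (at x)" "f x \<noteq> 0"
  shows "dir_deriv v (\<lambda>x. inverse (f x)) x = - (inverse (f x) * dir_deriv v f x * inverse (f x))"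
  by (rule dir_deriv_eq[OF Deriv.has_derivative_inverse[OF assms(2) has_derivative_dir_deriv[OF assms(1)]]])

lemma dir_deriv_chain:
  assumes "f differentiable (at x)" "g differentiable (at (f x))"
  shows "dir_deriv v (\<lambda>x. g (f x)) x = dir_deriv (dir_deriv v f x) g (f x)"
  using dir_deriv_eq[OF has_derivative_compose[OF assms[THEN has_derivative_dir_deriv]]] .

lemma dir_deriv_nth:
  fixes f :: "'a::real_normed_vector \<Rightarrow> 'b::real_normed_vector^'n"
  assumes "f differentiable (at x)"
  shows "dir_deriv v (\<lambda>x. f x $ i) x = dir_deriv v f x $ i"
  by (rule dir_deriv_eq)
     (rule bounded_linear.has_derivative[OF bounded_linear_vec_nth has_derivative_dir_deriv[OF assms]])

lemma differentiable_nth: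
  fixes f :: "'a::real_normed_vector \<Rightarrow> 'b::real_normed_vector^'n"
  assumes "f differentiable F"
  shows "(\<lambda>x. f x $ i) differentiable F"
  using assms bounded_linear.has_derivative[OF bounded_linear_vec_nth]
  unfolding differentiable_def by blast

lemma differentiable_sum_fun:
  assumes "\<And>i. i \<in> I \<Longrightarrow> f i differentiable F"
  shows "(\<lambda>x. \<Sum>i\<in>I. f i x) differentiable F"
  using assms by (induction I rule: infinite_finite_induct) auto

text \<open>A vector is the sum of its components pushed through the bounded linear embeddings
  \<open>axis i\<close>, which makes \<open>f\<close> a finite sum of differentiable maps.\<close>

lemma differentiable_vec_componentwise:
  fixes f :: "'a::real_normed_vector \<Rightarrow> 'b::real_normed_vector^'n"
  assumes "\<And>i. (\<lambda>x. f x $ i) differentiable (at x)"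
  shows "f differentiable (at x)"
proof -
  have axis: "bounded_linear (axis i :: 'b \<Rightarrow> 'b^'n)" for i
  proof (rule bounded_linear_intro[of _ 1])
    fix x :: 'b
    have "norm (axis i x :: 'b^'n) \<le> (\<Sum>j\<in>UNIV. norm ((axis i x :: 'b^'n) $ j))"
      unfolding norm_vec_def by (rule L2_set_le_sum) simp
    also have "\<dots> = (\<Sum>j\<in>UNIV. if j = i then norm x else 0)"
      by (rule sum.cong) (auto simp: axis_def)
    finally show "norm (axis i x :: 'b^'n) \<le> norm x * 1" by simp
  qed (auto simp: axis_def vec_eq_iff)
  have "(\<lambda>x. axis i (f x $ i)) differentiable (at x)" for i
    using assms[of i] bounded_linear.has_derivative[OF axis]
    unfolding differentiable_def by blast
  then have "(\<lambda>x. \<Sum>i\<in>UNIV. axis i (f x $ i)) differentiable (at x)"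
    by (intro differentiable_sum_fun)
  moreover have "(\<Sum>i\<in>UNIV. axis i (y $ i)) = y" for y :: "'b^'n"
    by (simp add: vec_eq_iff axis_def)
  ultimately show ?thesis by simp
qed

text \<open>Only the values of \<open>G\<close> on the fibre enter, so the identity may be frozen at the base point.\<close>

lemma dir_deriv_slice:
  fixes F G :: "'a::real_normed_vector \<times> 'b::real_normed_vector \<Rightarrow> 'c::real_normed_vector"
  assumes "open S" "z \<in> S" "F differentiable (at z)" "G differentiable (at z)"
    and eq: "\<And>w. w \<in> S \<Longrightarrow> fst w = fst z \<Longrightarrow> F w = G w"
  shows "dir_deriv (0, v) F z = dir_deriv (0, v) G z"
proof -
  let ?e = "\<lambda>y. (fst z, y)"
  have e: "(?e has_derivative (\<lambda>v. (0, v))) (at (snd z))"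
    by (auto intro!: derivative_eq_intros)
  have D: "((\<lambda>y. H (?e y)) has_derivative (\<lambda>v. dir_deriv (0, v) H z)) (at (snd z))"
    if "H differentiable (at z)" for H :: "'a \<times> 'b \<Rightarrow> 'c"
    using has_derivative_compose[OF e, of H "\<lambda>v. dir_deriv v H z"] has_derivative_dir_deriv[OF that]
    by simp
  have "open (?e -` S)"
    by (intro open_vimage assms continuous_intros)
  then have "((\<lambda>y. G (?e y)) has_derivative (\<lambda>v. dir_deriv (0, v) F z)) (at (snd z))"
  proof (rule has_derivative_transform_within_open[OF D[OF assms(3)]])
    show "snd z \<in> ?e -` S" using assms(2) by simp
    show "F (?e y) = G (?e y)" if "y \<in> ?e -` S" for y using eq that by simp
  qed
  then show ?thesis
    using has_derivative_unique[OF D[OF assms(4)]] by metis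
qed

section \<open>Calculus of smooth functions\<close>

lemma C_on_cong:
  assumes "open S" "\<And>x. x \<in> S \<Longrightarrow> f x = g x" "C_on k f S"
  shows "C_on k g S"
  using assms(2,3)
proof (induction k arbitrary: f g)
  case 0
  then show ?case using continuous_on_cong by (metis C_on.simps(1))
next
  case (Suc k)
  have "C_on k (dir_deriv v g) S" for v
    using Suc.IH[of "dir_deriv v f" "dir_deriv v g"] Suc.prems dir_deriv_cong_open[OF assms(1)]
    by (metis C_on.simps(2))
  moreover have "g differentiable (at x)" if "x \<in> S" for x
    using differentiable_cong_open[OF assms(1) that] Suc.prems that by auto
  ultimately show ?case by simp
qed

text \<open>\<open>C_on (Suc k)\<close> records differentiability in place of continuity, so the
  base case recovers continuity from it. The Leibniz rule depends on this descent in
  \<open>k\<close>, because it leaves one factor undifferentiated.\<close>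

lemma C_on_Suc_imp: "C_on (Suc k) f S \<Longrightarrow> C_on k f S"
proof (induction k arbitrary: f)
  case 0
  then show ?case
    by (auto intro!: differentiable_imp_continuous_on differentiable_at_imp_differentiable_on)
qed auto

lemma C_on_const: "C_on k (\<lambda>x::'a::euclidean_space. c) S"
proof (induction k arbitrary: c)
  case (Suc k)
  have "dir_deriv v (\<lambda>x::'a. c) = (\<lambda>x. 0)" for v by (rule ext) simp
  then show ?case using Suc by simp
qed simp

lemma C_on_bounded_linear: 
  assumes "bounded_linear h"
  shows "C_on k h S"
proof (cases k)
  case 0
  then show ?thesis using assms by (simp add: linear_continuous_on)
next
  case (Suc n)
  have "dir_deriv v h = (\<lambda>x. h v)" for v
    using dir_deriv_bounded_linear[OF assms] by blast
  then show ?thesis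
    using Suc assms by (simp add: C_on_const bounded_linear_imp_differentiable)
qed

lemma C_on_add:
  assumes "open S" "C_on k f S" "C_on k g S"
  shows "C_on k (\<lambda>x. f x + g x) S"
  using assms(2,3)
proof (induction k arbitrary: f g)
  case (Suc k)
  have "C_on k (dir_deriv v (\<lambda>x. f x + g x)) S" for v
    by (rule C_on_cong[OF assms(1) _ Suc.IH[of "dir_deriv v f" "dir_deriv v g"]])
       (use Suc.prems in \<open>auto simp: dir_deriv_add\<close>)
  then show ?case using Suc.prems by auto
qed (auto intro: continuous_intros)

lemma C_on_mult:
  fixes f g :: "'a::euclidean_space \<Rightarrow> real"
  assumes "open S" "C_on k f S" "C_on k g S"
  shows "C_on k (\<lambda>x. f x * g x) S"
  using assms(2,3)
proof (induction k arbitrary: f g)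
  case (Suc k)
  have "C_on k (dir_deriv v (\<lambda>x. f x * g x)) S" for v
  proof (rule C_on_cong[OF assms(1)])
    show "C_on k (\<lambda>x. dir_deriv v f x * g x + f x * dir_deriv v g x) S"
      using Suc.prems C_on_Suc_imp[OF Suc.prems(1)] C_on_Suc_imp[OF Suc.prems(2)]
      by (intro C_on_add[OF assms(1)] Suc.IH) auto
  qed (use Suc.prems in \<open>auto simp: dir_deriv_mult\<close>)
  then show ?case using Suc.prems by auto
qed (auto intro: continuous_intros)

text \<open>The derivative of the reciprocal is a product of the reciprocal with itself and a
  derivative of \<open>f\<close>, so the induction hypothesis covers every factor.\<close>

lemma C_on_inverse:
  fixes f :: "'a::euclidean_space \<Rightarrow> real"
  assumes "open S" "C_on k f S" "\<And>x. x \<in> S \<Longrightarrow> f x \<noteq> 0"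
  shows "C_on k (\<lambda>x. inverse (f x)) S"
  using assms(2)
proof (induction k)
  case (Suc k)
  have I: "C_on k (\<lambda>x. inverse (f x)) S"
    using Suc C_on_Suc_imp by blast
  have "C_on k (dir_deriv v (\<lambda>x. inverse (f x))) S" for v
  proof (rule C_on_cong[OF assms(1)])
    show "C_on k (\<lambda>x. (-1) * (inverse (f x) * dir_deriv v f x * inverse (f x))) S"
      using Suc.prems by (intro C_on_mult[OF assms(1)] I C_on_const) auto
  qed (use Suc.prems assms(3) in \<open>auto simp: dir_deriv_inverse\<close>)
  then show ?case using Suc.prems assms(3) by auto
qed (use assms in \<open>auto intro!: continuous_intros\<close>)

lemma C_on_nth:
  fixes f :: "'a::euclidean_space \<Rightarrow> 'b::real_normed_vector^'n"
  assumes "open S" "C_on k f S"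
  shows "C_on k (\<lambda>x. f x $ i) S"
  using assms(2)
proof (induction k arbitrary: f)
  case (Suc k)
  have "C_on k (dir_deriv v (\<lambda>x. f x $ i)) S" for v
    by (rule C_on_cong[OF assms(1) _ Suc.IH[of "dir_deriv v f"]])
       (use Suc.prems in \<open>auto simp: dir_deriv_nth\<close>)
  then show ?case using Suc.prems by (auto intro: differentiable_nth)
qed (auto intro: continuous_intros)

lemma C_on_vec:
  fixes f :: "'a::euclidean_space \<Rightarrow> 'b::real_normed_vector^'n"
  assumes "open S" "\<And>i. C_on k (\<lambda>x. f x $ i) S"
  shows "C_on k f S"
  using assms(2)
proof (induction k arbitrary: f)
  case 0
  then show ?case
    using continuous_on_vec_lambda[of S "\<lambda>i x. f x $ i"] by simp
next
  case (Suc k)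
  have d: "f differentiable (at x)" if "x \<in> S" for x
    using Suc.prems that by (intro differentiable_vec_componentwise) auto
  have "C_on k (\<lambda>x. dir_deriv v f x $ i) S" for v i
    by (rule C_on_cong[OF assms(1), of "dir_deriv v (\<lambda>x. f x $ i)"])
       (use Suc.prems d in \<open>auto simp: dir_deriv_nth\<close>)
  then show ?case using Suc.IH d by auto
qed

text \<open>The derivative in direction \<open>v\<close> is again a function of \<open>fst z\<close>
  alone, namely \<open>dir_deriv (fst v) f\<close>, so the induction reproduces the same
  shape.\<close>

lemma C_on_compose_fst:
  fixes f :: "'a::euclidean_space \<Rightarrow> 'c::real_normed_vector"
  assumes "open U" "C_on k f U"
  shows "C_on k (\<lambda>z::'a \<times> 'b::euclidean_space. f (fst z)) (U \<times> UNIV)"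
  using assms(2)
proof (induction k arbitrary: f)
  case 0
  then show ?case by (auto intro!: continuous_on_compose2[of U f] continuous_intros)
next
  case (Suc k)
  have D: "((\<lambda>z::'a \<times> 'b. f (fst z)) has_derivative (\<lambda>v. dir_deriv (fst v) f (fst z))) (at z)"
    if "z \<in> U \<times> UNIV" for z
    using that Suc.prems
    by (intro has_derivative_compose[OF bounded_linear_imp_has_derivative[OF bounded_linear_fst]]
        has_derivative_dir_deriv) auto
  have "C_on k (dir_deriv v (\<lambda>z::'a \<times> 'b. f (fst z))) (U \<times> UNIV)" for v
    by (rule C_on_cong[OF _ _ Suc.IH[of "dir_deriv (fst v) f"]])
       (use assms(1) Suc.prems in \<open>simp_all add: open_Times dir_deriv_eq[OF D]\<close>)
  moreover have "(\<lambda>z::'a \<times> 'b. f (fst z)) differentiable (at z)" if "z \<in> U \<times> UNIV" for z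
    using D[OF that] by (auto simp: differentiable_def)
  ultimately show ?case by simp
qed

text \<open>Near \<open>fst z\<close> the function \<open>f\<close> is recovered by composing with
  the local section \<open>\<lambda>x. (x, snd z)\<close>. Later this brings the smoothness of the
  Berwald symbols down to the base.\<close>

lemma C_on_fst_descend:
  fixes f :: "'a::euclidean_space \<Rightarrow> 'c::real_normed_vector"
    and S :: "('a \<times> 'b::euclidean_space) set"
  assumes "open S" "C_on k (\<lambda>z. f (fst z)) S"
  shows "C_on k f (fst ` S)"
  using assms(2)
proof (induction k arbitrary: f)
  case 0
  have oS: "open (fst ` S)"
    using assms(1) by (rule open_image_fst)
  have "isCont f (fst z)" if "z \<in> S" for z
  proof -
    have "isCont (\<lambda>z. f (fst z)) z"
      using 0 assms(1) that by (simp add: continuous_on_eq_continuous_at)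
    moreover have "isCont (\<lambda>x. (x, snd z)) (fst z)"
      by (intro continuous_intros)
    ultimately show ?thesis
      using isCont_o2[of "fst z" "\<lambda>x. (x, snd z)" "\<lambda>z. f (fst z)"] by simp
  qed
  then show ?case using oS by (auto simp: continuous_on_eq_continuous_at)
next
  case (Suc k)
  have D: "(f has_derivative (\<lambda>v. dir_deriv (v, 0) (\<lambda>z. f (fst z)) z)) (at (fst z))" if "z \<in> S" for z
  proof -
    have e: "((\<lambda>x. (x, snd z)) has_derivative (\<lambda>v. (v, 0))) (at (fst z))"
      by (auto intro!: derivative_eq_intros)
    have d: "(\<lambda>z. f (fst z)) differentiable (at z)"
      using Suc.prems that by simp
    have "((\<lambda>z. f (fst z)) has_derivative (\<lambda>v. dir_deriv v (\<lambda>z. f (fst z)) z)) (at (fst z, snd z))"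
      using has_derivative_dir_deriv[OF d] by simp
    from has_derivative_compose[OF e this] show ?thesis by simp
  qed
  have "C_on k (dir_deriv v f) (fst ` S)" for v
  proof (rule Suc.IH, rule C_on_cong[OF assms(1)])
    show "C_on k (dir_deriv (v, 0) (\<lambda>z. f (fst z))) S"
      using Suc.prems by simp
    show "dir_deriv (v, 0) (\<lambda>z. f (fst z)) z = dir_deriv v f (fst z)" if "z \<in> S" for z
      using dir_deriv_eq[OF D[OF that]] by (rule sym)
  qed
  moreover have "f differentiable (at x)" if "x \<in> fst ` S" for x
    using D that by (auto simp: differentiable_def)
  ultimately show ?case by simp
qed

lemma smooth_on_cong:
  "open S \<Longrightarrow> (\<And>x. x \<in> S \<Longrightarrow> f x = g x) \<Longrightarrow> smooth_on f S \<Longrightarrow> smooth_on g S"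
  using C_on_cong unfolding smooth_on_def by metis

lemma smooth_on_differentiable: "smooth_on f S \<Longrightarrow> x \<in> S \<Longrightarrow> f differentiable (at x)"
  unfolding smooth_on_def by (metis C_on.simps(2))

lemma smooth_on_dir_deriv: "smooth_on f S \<Longrightarrow> smooth_on (dir_deriv v f) S"
  unfolding smooth_on_def by (metis C_on.simps(2))

lemma smooth_on_continuous: "smooth_on f S \<Longrightarrow> continuous_on S f"
  unfolding smooth_on_def by (metis C_on.simps(1))

lemma smooth_on_const: "smooth_on (\<lambda>x. c) S"
  by (simp add: smooth_on_def C_on_const)

lemma smooth_on_bounded_linear: "bounded_linear h \<Longrightarrow> smooth_on h S"
  by (simp add: smooth_on_def C_on_bounded_linear)

lemma smooth_on_add:
  "open S \<Longrightarrow> smooth_on f S \<Longrightarrow> smooth_on g S \<Longrightarrow> smooth_on (\<lambda>x. f x + g x) S"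
  by (simp add: smooth_on_def C_on_add)

lemma smooth_on_mult:
  fixes f g :: "'a::euclidean_space \<Rightarrow> real"
  shows "open S \<Longrightarrow> smooth_on f S \<Longrightarrow> smooth_on g S \<Longrightarrow> smooth_on (\<lambda>x. f x * g x) S"
  by (simp add: smooth_on_def C_on_mult)

lemma smooth_on_inverse:
  fixes f :: "'a::euclidean_space \<Rightarrow> real"
  shows "open S \<Longrightarrow> smooth_on f S \<Longrightarrow> (\<And>x. x \<in> S \<Longrightarrow> f x \<noteq> 0) \<Longrightarrow> smooth_on (\<lambda>x. inverse (f x)) S"
  by (simp add: smooth_on_def C_on_inverse)

lemma smooth_on_diff:
  fixes f g :: "'a::euclidean_space \<Rightarrow> real"
  assumes "open S" "smooth_on f S" "smooth_on g S"
  shows "smooth_on (\<lambda>x. f x - g x) S"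
  using smooth_on_add[OF assms(1,2) smooth_on_mult[OF assms(1) smooth_on_const[of "-1"] assms(3)]]
  by simp

lemma smooth_on_sum:
  assumes "open S" "\<And>i. i \<in> I \<Longrightarrow> smooth_on (f i) S"
  shows "smooth_on (\<lambda>x. \<Sum>i\<in>I. f i x) S"
  using assms(2)
  by (induction I rule: infinite_finite_induct) (auto intro: smooth_on_add assms(1) smooth_on_const)

lemma smooth_on_prod:
  fixes f :: "'i \<Rightarrow> 'a::euclidean_space \<Rightarrow> real"
  assumes "open S" "\<And>i. i \<in> I \<Longrightarrow> smooth_on (f i) S"
  shows "smooth_on (\<lambda>x. \<Prod>i\<in>I. f i x) S"
  using assms(2)
  by (induction I rule: infinite_finite_induct) (auto intro: smooth_on_mult assms(1) smooth_on_const)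

lemma smooth_on_nth:
  fixes f :: "'a::euclidean_space \<Rightarrow> 'b::real_normed_vector^'n"
  shows "open S \<Longrightarrow> smooth_on f S \<Longrightarrow> smooth_on (\<lambda>x. f x $ i) S"
  by (simp add: smooth_on_def C_on_nth)

lemma smooth_on_vec:
  fixes f :: "'a::euclidean_space \<Rightarrow> 'b::real_normed_vector^'n"
  shows "open S \<Longrightarrow> (\<And>i. smooth_on (\<lambda>x. f x $ i) S) \<Longrightarrow> smooth_on f S"
  by (simp add: smooth_on_def C_on_vec)

lemma smooth_on_nth3:
  fixes G :: "'a::euclidean_space \<Rightarrow> real^'n^'m^'k"
  assumes "open S"
  shows "smooth_on G S \<longleftrightarrow> (\<forall>j i k. smooth_on (\<lambda>x. G x $ j $ i $ k) S)"
proof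
  assume "smooth_on G S"
  then show "\<forall>j i k. smooth_on (\<lambda>x. G x $ j $ i $ k) S"
    by (intro allI smooth_on_nth assms)
next
  assume "\<forall>j i k. smooth_on (\<lambda>x. G x $ j $ i $ k) S"
  then show "smooth_on G S"
    by (intro smooth_on_vec assms) auto
qed

lemma smooth_on_compose_fst:
  fixes f :: "'a::euclidean_space \<Rightarrow> 'c::real_normed_vector"
  shows "open U \<Longrightarrow> smooth_on f U \<Longrightarrow>
    smooth_on (\<lambda>z::'a \<times> 'b::euclidean_space. f (fst z)) (U \<times> UNIV)"
  by (simp add: smooth_on_def C_on_compose_fst)

lemma smooth_on_fst_descend:
  fixes S :: "('a::euclidean_space \<times> 'b::euclidean_space) set"
  shows "open S \<Longrightarrow> smooth_on (\<lambda>z. f (fst z)) S \<Longrightarrow> smooth_on f (fst ` S)"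
  by (simp add: smooth_on_def C_on_fst_descend)

section \<open>Determinants and inverses of smooth matrices\<close>

lemma smooth_on_det:
  fixes M :: "'a::euclidean_space \<Rightarrow> real^'n^'n"
  assumes "open S" "\<And>i j. smooth_on (\<lambda>x. M x $ i $ j) S"
  shows "smooth_on (\<lambda>x. det (M x)) S"
  unfolding det_def
  by (intro smooth_on_sum smooth_on_mult smooth_on_prod smooth_on_const assms)

lemma matrix_inv_mult:
  fixes A :: "'a::semiring_1^'n^'n"
  assumes "invertible A"
  shows "A ** matrix_inv A = mat 1" "matrix_inv A ** A = mat 1"
  using assms unfolding invertible_def matrix_inv_def
  by (metis (mono_tags, lifting) someI_ex)+

text \<open>Cramer's rule, applied to the columns of the inverse. It displays each entry as a
  quotient of polynomials in the entries of \<open>A\<close>, hence as a smooth function of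
  them.\<close>

lemma matrix_inv_nth:
  fixes A :: "real^'n^'n"
  assumes "invertible A"
  shows "matrix_inv A $ k $ l = det (\<chi> i j. if j = k then axis l 1 $ i else A $ i $ j) / det A"
proof -
  have "A *v (matrix_inv A *v axis l 1) = axis l 1"
    by (simp add: matrix_vector_mul_assoc matrix_inv_mult[OF assms])
  moreover have "det A \<noteq> 0"
    using assms invertible_det_nz by blast
  ultimately have "matrix_inv A *v axis l 1 =
      (\<chi> k. det (\<chi> i j. if j = k then axis l 1 $ i else A $ i $ j) / det A)"
    using cramer by blast
  moreover have "(matrix_inv A *v axis l 1) $ k = matrix_inv A $ k $ l"
    by (simp add: matrix_vector_mult_basis column_def)
  ultimately show ?thesis by simp
qed

lemma smooth_on_matrix_inv:
  fixes M :: "'a::euclidean_space \<Rightarrow> real^'n^'n"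
  assumes "open S" and sm: "\<And>i j. smooth_on (\<lambda>x. M x $ i $ j) S"
    and inv: "\<And>x. x \<in> S \<Longrightarrow> invertible (M x)"
  shows "smooth_on (\<lambda>x. matrix_inv (M x) $ k $ l) S"
proof (rule smooth_on_cong[OF assms(1)])
  have "smooth_on (\<lambda>x. (\<chi> i j. if j = k then axis l 1 $ i else M x $ i $ j) $ i $ j) S" for i j
    using sm smooth_on_const by (cases "j = k") auto
  then show "smooth_on (\<lambda>x. det (\<chi> i j. if j = k then axis l 1 $ i else M x $ i $ j)
      * inverse (det (M x))) S"
    by (intro smooth_on_mult smooth_on_inverse smooth_on_det sm assms(1))
       (use inv invertible_det_nz in blast)+
qed (simp add: matrix_inv_nth inv divide_inverse)

section \<open>Symmetry of second derivatives\<close>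

lemma second_difference_mean_value:
  fixes f :: "'a::real_normed_vector \<Rightarrow> real"
  assumes h: "0 < h"
    and box: "\<And>s t. 0 \<le> s \<Longrightarrow> s \<le> h \<Longrightarrow> 0 \<le> t \<Longrightarrow> t \<le> h \<Longrightarrow> z + s *\<^sub>R u + t *\<^sub>R v \<in> S"
    and f: "\<And>x. x \<in> S \<Longrightarrow> f differentiable (at x)"
    and df: "\<And>x. x \<in> S \<Longrightarrow> dir_deriv u f differentiable (at x)"
  shows "\<exists>s t. 0 < s \<and> s < h \<and> 0 < t \<and> t < h \<and>
    f (z + h *\<^sub>R u + h *\<^sub>R v) - f (z + h *\<^sub>R u) - f (z + h *\<^sub>R v) + f z =
      h * h * dir_deriv v (dir_deriv u f) (z + s *\<^sub>R u + t *\<^sub>R v)"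
proof -
  have line: "((\<lambda>s. F (p + s *\<^sub>R w)) has_field_derivative dir_deriv w F (p + s *\<^sub>R w)) (at s)"
    if "F differentiable (at (p + s *\<^sub>R w))" for F :: "'a \<Rightarrow> real" and p w s
  proof -
    have "((\<lambda>s. p + s *\<^sub>R w) has_derivative (\<lambda>s. s *\<^sub>R w)) (at s)"
      by (auto intro!: derivative_eq_intros)
    from has_derivative_compose[OF this has_derivative_dir_deriv[OF that]]
    have "((\<lambda>s. F (p + s *\<^sub>R w)) has_derivative (\<lambda>r. dir_deriv (r *\<^sub>R w) F (p + s *\<^sub>R w))) (at s)" .
    moreover have "dir_deriv (r *\<^sub>R w) F (p + s *\<^sub>R w) = dir_deriv w F (p + s *\<^sub>R w) * r" for r
      using linear_scale[OF linear_dir_deriv[OF that]] by simp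
    ultimately show ?thesis by (simp add: has_field_derivative_def)
  qed
  \<comment> \<open>\<open>?g\<close> is the increment of \<open>f\<close> across
    \<open>h *\<^sub>R v\<close>, followed along \<open>u\<close>, so \<open>?g h - ?g 0\<close> is
    the second difference. The mean value theorem turns it into \<open>h\<close> times an increment
    of \<open>dir_deriv u f\<close> along \<open>v\<close>, to which the theorem is applied
    again.\<close>
  let ?g = "\<lambda>s. f ((z + h *\<^sub>R v) + s *\<^sub>R u) - f (z + s *\<^sub>R u)"
  let ?g' = "\<lambda>s. dir_deriv u f ((z + h *\<^sub>R v) + s *\<^sub>R u) - dir_deriv u f (z + s *\<^sub>R u)"
  have in1: "(z + h *\<^sub>R v) + s *\<^sub>R u \<in> S" if "0 \<le> s" "s \<le> h" for s
    using box[of s h] that h by (simp add: algebra_simps)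
  have in2: "z + s *\<^sub>R u \<in> S" if "0 \<le> s" "s \<le> h" for s
    using box[of s 0] that h by simp
  have "\<exists>s>0. s < h \<and> ?g h - ?g 0 = (h - 0) * ?g' s"
    by (intro MVT2 h DERIV_diff line f in1 in2)
  then obtain s where s: "0 < s" "s < h" "?g h - ?g 0 = h * ?g' s" by auto
  let ?k = "\<lambda>t. dir_deriv u f ((z + s *\<^sub>R u) + t *\<^sub>R v)"
  have "\<exists>t>0. t < h \<and> ?k h - ?k 0 = (h - 0) * dir_deriv v (dir_deriv u f) ((z + s *\<^sub>R u) + t *\<^sub>R v)"
    using s by (intro MVT2 h line df box) auto
  then obtain t where t: "0 < t" "t < h"
    "?k h - ?k 0 = h * dir_deriv v (dir_deriv u f) ((z + s *\<^sub>R u) + t *\<^sub>R v)" by auto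
  have "?g' s = ?k h - ?k 0" by (simp add: algebra_simps)
  then have "?g h - ?g 0 = h * h * dir_deriv v (dir_deriv u f) ((z + s *\<^sub>R u) + t *\<^sub>R v)"
    using s(3) t(3) by simp
  then show ?thesis using s(1,2) t(1,2) by (intro exI[of _ s] exI[of _ t]) (simp add: algebra_simps)
qed

text \<open>The second difference of \<open>f\<close> over a parallelogram is symmetric in
  \<open>u\<close> and \<open>v\<close>. It equals \<open>h * h\<close> times a value of either
  mixed derivative near \<open>z\<close>, so continuity at \<open>z\<close> forces the two to agree
  there.\<close>

lemma dir_deriv_commute:
  fixes f :: "'a::euclidean_space \<Rightarrow> real"
  assumes "open S" "z \<in> S" "smooth_on f S"
  shows "dir_deriv u (dir_deriv v f) z = dir_deriv v (dir_deriv u f) z"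
proof (rule ccontr)
  let ?P = "dir_deriv u (dir_deriv v f)" and ?Q = "dir_deriv v (dir_deriv u f)"
  assume ne: "?P z \<noteq> ?Q z"
  \<comment> \<open>Half the gap: the mean value points of the two mixed derivatives differ, and
    each value lies within \<open>e\<close> of the one at \<open>z\<close>.\<close>
  define e where "e = \<bar>?P z - ?Q z\<bar> / 2"
  have e: "e > 0" using ne by (simp add: e_def)
  have "isCont ?P z" "isCont ?Q z"
    using smooth_on_continuous[OF smooth_on_dir_deriv[OF smooth_on_dir_deriv[OF assms(3)]]] assms(1,2)
    by (auto simp: continuous_on_eq_continuous_at)
  then obtain d1 d2 where d: "d1 > 0" "d2 > 0"
      "\<And>x. dist x z < d1 \<Longrightarrow> \<bar>?P x - ?P z\<bar> < e" "\<And>x. dist x z < d2 \<Longrightarrow> \<bar>?Q x - ?Q z\<bar> < e"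
    using e unfolding continuous_at_eps_delta dist_real_def by metis
  obtain d3 where d3: "d3 > 0" "ball z d3 \<subseteq> S"
    using assms(1,2) openE by blast
  define d where "d = Min {d1, d2, d3}"
  have d0: "d > 0" "d \<le> d1" "d \<le> d2" "d \<le> d3" using d d3 by (auto simp: d_def)
  \<comment> \<open>This size keeps the whole parallelogram within distance \<open>d\<close> of
    \<open>z\<close>; the summand 1 keeps the denominator positive even for
    \<open>u = v = 0\<close>.\<close>
  define h where "h = d / (norm u + norm v + 1)"
  have pos: "norm u + norm v + 1 > 0" by (simp add: add_nonneg_pos)
  have h: "h > 0" using d0 pos by (simp add: h_def)
  have near: "dist (z + s *\<^sub>R u + t *\<^sub>R v) z < d" if "0 \<le> s" "s \<le> h" "0 \<le> t" "t \<le> h" for s t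
  proof -
    have "dist (z + s *\<^sub>R u + t *\<^sub>R v) z \<le> s * norm u + t * norm v"
      using norm_triangle_ineq[of "s *\<^sub>R u" "t *\<^sub>R v"] that by (simp add: dist_norm)
    also have "\<dots> \<le> h * norm u + h * norm v"
      using that by (intro add_mono mult_right_mono) auto
    also have "\<dots> < h * (norm u + norm v + 1)" using h by (simp add: algebra_simps)
    also have "\<dots> = d" using pos by (simp add: h_def)
    finally show ?thesis .
  qed
  have inS: "z + s *\<^sub>R u + t *\<^sub>R v \<in> S" if "0 \<le> s" "s \<le> h" "0 \<le> t" "t \<le> h" for s t
    using near[OF that] d0(4) d3(2) by (auto simp: dist_commute subset_iff)
  have dif: "f differentiable (at x)" "dir_deriv w f differentiable (at x)" if "x \<in> S" for x w
    using smooth_on_differentiable[OF _ that] smooth_on_dir_deriv assms(3) by auto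
  let ?\<Delta> = "f (z + h *\<^sub>R u + h *\<^sub>R v) - f (z + h *\<^sub>R u) - f (z + h *\<^sub>R v) + f z"
  obtain s t where st: "0 < s" "s < h" "0 < t" "t < h" 
    "?\<Delta> = h * h * ?Q (z + s *\<^sub>R u + t *\<^sub>R v)"
    using second_difference_mean_value[OF h inS dif] by blast
  have inS': "z + s *\<^sub>R v + t *\<^sub>R u \<in> S" if "0 \<le> s" "s \<le> h" "0 \<le> t" "t \<le> h" for s t
    using inS[of t s] that by (simp add: algebra_simps)
  \<comment> \<open>The same second difference, with the roles of the two directions
    exchanged.\<close>
  obtain s' t' where st': "0 < s'" "s' < h" "0 < t'" "t' < h" 
    "?\<Delta> = h * h * ?P (z + t' *\<^sub>R u + s' *\<^sub>R v)"
    using second_difference_mean_value[OF h inS' dif] by (auto simp: algebra_simps)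
  have "\<bar>?Q (z + s *\<^sub>R u + t *\<^sub>R v) - ?Q z\<bar> < e"
    using near[of s t] st d0 by (intro d) auto
  moreover have "\<bar>?P (z + t' *\<^sub>R u + s' *\<^sub>R v) - ?P z\<bar> < e"
    using near[of t' s'] st' d0 by (intro d) auto
  moreover have "?Q (z + s *\<^sub>R u + t *\<^sub>R v) = ?P (z + t' *\<^sub>R u + s' *\<^sub>R v)"
    using st(5) st'(5) h by simp
  ultimately have "\<bar>?P z - ?Q z\<bar> < 2 * e" by linarith
  then show False by (simp add: e_def)
qed

section \<open>Finsler Lagrangians in bundle coordinates\<close>

lemma vec_eq_sum_axis: "(\<Sum>i\<in>UNIV. (x $ i) *\<^sub>R axis i (1::real)) = x"
  using basis_expansion[of x] by (simp add: scalar_mult_eq_scaleR)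

lemma dir_deriv_partial:
  fixes f :: "real^'n \<Rightarrow> real"
  assumes "f differentiable (at x)"
  shows "dir_deriv v f x = (\<Sum>i\<in>UNIV. v $ i * partial i f x)"
proof -
  interpret linear "\<lambda>v. dir_deriv v f x" by (rule linear_dir_deriv[OF assms])
  show ?thesis
    by (subst (1) vec_eq_sum_axis[symmetric]) (simp add: sum scale)
qed

lemma dir_deriv_partial_xy:
  fixes F :: "(real^'n) \<times> (real^'n) \<Rightarrow> real"
  assumes "F differentiable (at z)"
  shows "dir_deriv (u, v) F z =
    (\<Sum>i\<in>UNIV. u $ i * partial_x i F z) + (\<Sum>i\<in>UNIV. v $ i * partial_y i F z)"
proof -
  interpret linear "\<lambda>v. dir_deriv v F z" by (rule linear_dir_deriv[OF assms])
  have "(u, v) = (\<Sum>i\<in>UNIV. (u $ i) *\<^sub>R (axis i 1, 0)) + (\<Sum>i\<in>UNIV. (v $ i) *\<^sub>R (0, axis i 1))"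
    by (simp add: prod_eq_iff fst_sum snd_sum vec_eq_sum_axis)
  then show ?thesis by (simp add: add sum scale del: scaleR_Pair)
qed

lemma bounded_linear_snd_nth: "bounded_linear (\<lambda>z::'a::real_normed_vector \<times> (real^'n). snd z $ j)"
  by (rule bounded_linear_compose[OF bounded_linear_vec_nth bounded_linear_snd])

lemma dir_deriv_snd_nth [simp]:
  "dir_deriv w (\<lambda>z::'a::real_normed_vector \<times> (real^'n). snd z $ j) z = snd w $ j"
  by (rule dir_deriv_bounded_linear[OF bounded_linear_snd_nth])

lemma differentiable_snd_nth [simp]:
  "(\<lambda>z::'a::real_normed_vector \<times> (real^'n). snd z $ j) differentiable F"
  by (rule bounded_linear_imp_differentiable[OF bounded_linear_snd_nth])

lemma smooth_on_snd_nth: "smooth_on (\<lambda>z::'a::euclidean_space \<times> (real^'n). snd z $ j) S"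
  by (rule smooth_on_bounded_linear[OF bounded_linear_snd_nth])

lemma sum_axis_mult [simp]:
  fixes f :: "'n::finite \<Rightarrow> real"
  shows "(\<Sum>j\<in>UNIV. axis i 1 $ j * f j) = f i" "(\<Sum>j\<in>UNIV. f j * axis i 1 $ j) = f i"
proof -
  have "(\<Sum>j\<in>UNIV. axis i 1 $ j * f j) = (\<Sum>j\<in>UNIV. if j = i then f j else 0)"
    by (rule sum.cong) (auto simp: axis_def)
  then show "(\<Sum>j\<in>UNIV. axis i 1 $ j * f j) = f i" by simp
  then show "(\<Sum>j\<in>UNIV. f j * axis i 1 $ j) = f i" by (simp add: mult.commute)
qed

text \<open>The acceleration-free part of the Euler-Lagrange expression of \<open>L\<close>: along a
  curve with velocity \<open>y\<close> the full expression adds twice the fundamental tensor applied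
  to the acceleration.\<close>

definition spray_covector ::
    "((real^'n::finite) \<times> (real^'n) \<Rightarrow> real) \<Rightarrow> 'n \<Rightarrow> (real^'n) \<times> (real^'n) \<Rightarrow> real"
  where "spray_covector L k w =
    (\<Sum>m\<in>UNIV. snd w $ m * partial_x m (partial_y k L) w) - partial_x k L w"

text \<open>Geodesics have acceleration minus one half of this vector. In the customary
  normalisation, where the acceleration is minus twice the spray coefficients, these are a quarter
  of it, whence the factor 1/4 in \<open>canonical_N\<close>.\<close>

definition spray_vector ::
    "((real^'n::finite) \<times> (real^'n) \<Rightarrow> real) \<Rightarrow> 'n \<Rightarrow> (real^'n) \<times> (real^'n) \<Rightarrow> real"
  where "spray_vector L j w =
    (\<Sum>k\<in>UNIV. matrix_inv (fundamental_tensor L w) $ j $ k * spray_covector L k w)"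

lemma canonical_N_spray: "canonical_N L j i z = 1/4 * partial_y i (spray_vector L j) z"
  by (simp add: canonical_N_def spray_vector_def[abs_def] spray_covector_def[abs_def])

definition symmetric_symbols :: "real^'n^'n^'n \<Rightarrow> bool"
  where "symmetric_symbols G \<longleftrightarrow> (\<forall>j i k. G $ j $ i $ k = G $ j $ k $ i)"

text \<open>Compatibility at one base point, with \<open>G\<close> a plain array. No regularity in
  \<open>x\<close> enters, so it can be stated for the symbols that \<open>berwald_type\<close>
  provides before they are known to be smooth.\<close>

definition compatible_over ::
    "((real^'n::finite) \<times> (real^'n)) set \<Rightarrow> ((real^'n) \<times> (real^'n) \<Rightarrow> real) \<Rightarrow> real^'n \<Rightarrow>
     real^'n^'n^'n \<Rightarrow> bool"
  where "compatible_over S L x G \<longleftrightarrow> (\<forall>w\<in>S. fst w = x \<longrightarrow> (\<forall>i.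
    partial_x i L w = (\<Sum>j\<in>UNIV. (\<Sum>k\<in>UNIV. G $ j $ i $ k * snd w $ k) * partial_y j L w)))"

text \<open>Detached from the manifold, since it is used for two Lagrangians on different domains:
  the coordinate form of \<open>L\<close> on its cone, and the quadratic form of a metric on all
  tangent vectors over a chart.\<close>

locale finsler_chart =
  fixes S :: "((real^'n::finite) \<times> (real^'n)) set"
    and L :: "(real^'n) \<times> (real^'n) \<Rightarrow> real"
  assumes open_S: "open S"
    and smooth_L: "smooth_on L S"
    and cone: "z \<in> S \<Longrightarrow> t > 0 \<Longrightarrow> (fst z, t *\<^sub>R snd z) \<in> S"
    and homogeneous: "z \<in> S \<Longrightarrow> t > 0 \<Longrightarrow> L (fst z, t *\<^sub>R snd z) = t\<^sup>2 * L z"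
    and nondegenerate: "z \<in> S \<Longrightarrow> invertible (fundamental_tensor L z)"
begin

abbreviation g where "g \<equiv> fundamental_tensor L"

lemma g_nth: "g z $ i $ j = 1/2 * partial_y i (partial_y j L) z"
  by (simp add: fundamental_tensor_def)

lemma diff_L: "z \<in> S \<Longrightarrow> L differentiable (at z)"
  by (rule smooth_on_differentiable[OF smooth_L])

lemma diff_dL: "z \<in> S \<Longrightarrow> dir_deriv v L differentiable (at z)"
  by (rule smooth_on_differentiable[OF smooth_on_dir_deriv[OF smooth_L]])

lemma diff_ddL: "z \<in> S \<Longrightarrow> dir_deriv u (dir_deriv v L) differentiable (at z)"
  by (rule smooth_on_differentiable[OF smooth_on_dir_deriv[OF smooth_on_dir_deriv[OF smooth_L]]])

lemma commute_L: "z \<in> S \<Longrightarrow> dir_deriv u (dir_deriv v L) z = dir_deriv v (dir_deriv u L) z"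
  by (rule dir_deriv_commute[OF open_S _ smooth_L])

text \<open>Carries the outermost direction to the innermost place, where a known formula for the
  first derivative of \<open>L\<close> can be substituted.\<close>

lemma commute_dL:
  assumes z: "z \<in> S"
  shows "dir_deriv u (dir_deriv v (dir_deriv w L)) z = dir_deriv v (dir_deriv w (dir_deriv u L)) z"
proof -
  have "dir_deriv u (dir_deriv v (dir_deriv w L)) z = dir_deriv v (dir_deriv u (dir_deriv w L)) z"
    by (rule dir_deriv_commute[OF open_S z smooth_on_dir_deriv[OF smooth_L]])
  also have "\<dots> = dir_deriv v (dir_deriv w (dir_deriv u L)) z"
    by (rule dir_deriv_cong_open[OF open_S z commute_L])
  finally show ?thesis .
qed

lemma g_sym: "z \<in> S \<Longrightarrow> g z $ i $ j = g z $ j $ i"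
  by (simp add: g_nth commute_L)

lemma smooth_g: "smooth_on (\<lambda>z. g z $ i $ j) S"
  unfolding g_nth
  by (intro smooth_on_mult smooth_on_const smooth_on_dir_deriv open_S smooth_L)

lemma smooth_spray_vector: "smooth_on (spray_vector L j) S"
  unfolding spray_vector_def[abs_def] spray_covector_def[abs_def]
  by (intro smooth_on_sum smooth_on_mult smooth_on_diff smooth_on_matrix_inv smooth_on_dir_deriv
      smooth_g smooth_L open_S nondegenerate smooth_on_snd_nth)

lemma smooth_canonical_N: "smooth_on (canonical_N L j i) S"
  unfolding canonical_N_spray[abs_def]
  by (intro smooth_on_mult smooth_on_const smooth_on_dir_deriv smooth_spray_vector open_S)

lemma smooth_berwald_symbol: "smooth_on (berwald_symbol L k i j) S"
  unfolding berwald_symbol_def by (intro smooth_on_dir_deriv smooth_canonical_N)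

text \<open>Up to the factor 1/4 the Berwald symbols are second \<open>y\<close>-derivatives of the
  spray vector. This is the source of torsion-freeness.\<close>

lemma berwald_symbol_sym: "z \<in> S \<Longrightarrow> berwald_symbol L k i j z = berwald_symbol L k j i z"
proof -
  assume z: "z \<in> S"
  have eq: "berwald_symbol L k i j z = 1/4 * partial_y j (partial_y i (spray_vector L k)) z" for i j
    unfolding berwald_symbol_def canonical_N_spray[abs_def]
    by (rule dir_deriv_cmult)
       (rule smooth_on_differentiable[OF smooth_on_dir_deriv[OF smooth_spray_vector] z])
  have "partial_y j (partial_y i (spray_vector L k)) z = partial_y i (partial_y j (spray_vector L k)) z"
    by (rule dir_deriv_commute[OF open_S z smooth_spray_vector])
  then show ?thesis unfolding eq by simp
qed

lemma euler:
  assumes z: "z \<in> S"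
  shows "(\<Sum>j\<in>UNIV. snd z $ j * partial_y j L z) = 2 * L z"
proof -
  \<comment> \<open>The derivative of \<open>L\<close> at \<open>t = 1\<close> along the ray through
    \<open>z\<close> is computed twice, by the chain rule and from homogeneity.\<close>
  let ?e = "\<lambda>t. (fst z, t *\<^sub>R snd z)"
  have e: "(?e has_derivative (\<lambda>t. (0, t *\<^sub>R snd z))) (at (1::real))"
    by (auto intro!: derivative_eq_intros)
  have "(L has_derivative (\<lambda>v. dir_deriv v L z)) (at (?e 1))"
    using has_derivative_dir_deriv[OF diff_L[OF z]] by simp
  from has_derivative_compose[OF e this]
  have "((\<lambda>t. L (?e t)) has_derivative (\<lambda>t. dir_deriv (0, t *\<^sub>R snd z) L z)) (at 1)" .
  moreover have "((\<lambda>t. L (?e t)) has_derivative (\<lambda>t. 2 * t * L z)) (at 1)"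
  proof (rule has_derivative_transform_within_open)
    show "((\<lambda>t. t\<^sup>2 * L z) has_derivative (\<lambda>t. 2 * t * L z)) (at 1)"
      by (auto intro!: derivative_eq_intros)
    show "t\<^sup>2 * L z = L (?e t)" if "t \<in> {0<..}" for t
      using homogeneous[OF z] that by simp
  qed auto
  ultimately have "dir_deriv (0, 1 *\<^sub>R snd z) L z = 2 * 1 * L z"
    using has_derivative_unique by metis
  then show ?thesis
    using dir_deriv_partial_xy[OF diff_L[OF z], of 0 "snd z"] by simp
qed

text \<open>Euler's identity differentiated in an arbitrary direction. Vertical directions yield the
  contraction of the fundamental tensor with \<open>y\<close>; horizontal ones say that
  \<open>x\<close>-derivatives of \<open>L\<close> are again homogeneous of degree 2.\<close>

lemma euler_deriv:
  assumes z: "z \<in> S"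
  shows "(\<Sum>j\<in>UNIV. snd z $ j * dir_deriv w (partial_y j L) z) =
    2 * dir_deriv w L z - (\<Sum>j\<in>UNIV. snd w $ j * partial_y j L z)"
proof -
  have "dir_deriv w (\<lambda>z. \<Sum>j\<in>UNIV. snd z $ j * partial_y j L z) z = dir_deriv w (\<lambda>z. 2 * L z) z"
    by (rule dir_deriv_cong_open[OF open_S z euler])
  then show ?thesis
    using z by (simp add: dir_deriv_sum dir_deriv_mult dir_deriv_cmult diff_L diff_dL sum.distrib)
qed

lemma g_contract:
  assumes z: "z \<in> S"
  shows "(\<Sum>j\<in>UNIV. snd z $ j * g z $ j $ k) = 1/2 * partial_y k L z"
proof -
  have "(\<Sum>j\<in>UNIV. snd z $ j * g z $ j $ k) = 1/2 * (\<Sum>j\<in>UNIV. snd z $ j * g z $ k $ j * 2)"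
    unfolding sum_distrib_left using g_sym[OF z] by (intro sum.cong) auto
  also have "(\<Sum>j\<in>UNIV. snd z $ j * g z $ k $ j * 2) = partial_y k L z"
    using euler_deriv[OF z, of "(0, axis k 1)"] by (simp add: g_nth)
  finally show ?thesis .
qed

lemma g_spray_vector:
  assumes z: "z \<in> S"
  shows "(\<Sum>k\<in>UNIV. g z $ j $ k * spray_vector L k z) = spray_covector L j z"
proof -
  let ?P = "\<chi> k. spray_covector L k z"
  have "g z *v (matrix_inv (g z) *v ?P) = ?P"
    by (simp add: matrix_vector_mul_assoc matrix_inv_mult nondegenerate z)
  then have "(g z *v (matrix_inv (g z) *v ?P)) $ j = spray_covector L j z"
    by simp
  then show ?thesis
    by (simp add: matrix_vector_mult_def spray_vector_def)
qed

text \<open>By \<open>g_contract\<close>, half of the left side is \<open>y\<close> contracted with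
  the spray covector. There Euler's identity for the \<open>x\<close>-derivatives makes the first
  term twice the second, leaving one copy of \<open>y\<close> applied to the
  \<open>x\<close>-gradient.\<close>

lemma spray_vector_contract:
  assumes z: "z \<in> S"
  shows "(\<Sum>k\<in>UNIV. partial_y k L z * spray_vector L k z) = 
    2 * (\<Sum>m\<in>UNIV. snd z $ m * partial_x m L z)"
proof -
  have "1/2 * (\<Sum>k\<in>UNIV. partial_y k L z * spray_vector L k z) =
      (\<Sum>k\<in>UNIV. (1/2 * partial_y k L z) * spray_vector L k z)"
    unfolding sum_distrib_left by (simp add: mult.assoc)
  also have "\<dots> = (\<Sum>k\<in>UNIV. \<Sum>j\<in>UNIV. snd z $ j * (g z $ j $ k * spray_vector L k z))"
    unfolding g_contract[OF z, symmetric] sum_distrib_right by (simp add: mult.assoc)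
  also have "\<dots> = (\<Sum>j\<in>UNIV. snd z $ j * spray_covector L j z)"
    by (subst sum.swap) (simp add: sum_distrib_left[symmetric] g_spray_vector[OF z])
  also have "\<dots> = (\<Sum>j\<in>UNIV. \<Sum>m\<in>UNIV. snd z $ m * (snd z $ j * partial_x m (partial_y j L) z))
      - (\<Sum>j\<in>UNIV. snd z $ j * partial_x j L z)"
    unfolding spray_covector_def right_diff_distrib sum_subtractf sum_distrib_left
    by (simp add: mult.left_commute)
  also have "(\<Sum>j\<in>UNIV. \<Sum>m\<in>UNIV. snd z $ m * (snd z $ j * partial_x m (partial_y j L) z)) =
      2 * (\<Sum>m\<in>UNIV. snd z $ m * partial_x m L z)"
    by (subst sum.swap)
       (simp add: sum_distrib_left[symmetric] euler_deriv[OF z], simp add: sum_distrib_left mult.left_commute)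
  finally show ?thesis by simp
qed

text \<open>Differentiating the contraction of the spray with \<open>y\<close>, rather than contracting its derivative,
  avoids third derivatives of \<open>L\<close>.\<close>

lemma horizontal_deriv_L:
  assumes z: "z \<in> S"
  shows "partial_x i L z = (\<Sum>k\<in>UNIV. canonical_N L k i z * partial_y k L z)"
proof -
  have dsp: "spray_vector L k differentiable (at z)" for k
    by (rule smooth_on_differentiable[OF smooth_spray_vector z])
  have "partial_y i (\<lambda>z. \<Sum>k\<in>UNIV. partial_y k L z * spray_vector L k z) z =
      partial_y i (\<lambda>z. 2 * (\<Sum>m\<in>UNIV. snd z $ m * partial_x m L z)) z"
    by (rule dir_deriv_cong_open[OF open_S z spray_vector_contract])
  moreover have "partial_y i (\<lambda>z. \<Sum>k\<in>UNIV. partial_y k L z * spray_vector L k z) z =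
      (\<Sum>k\<in>UNIV. partial_y i (partial_y k L) z * spray_vector L k z) +
      (\<Sum>k\<in>UNIV. partial_y k L z * partial_y i (spray_vector L k) z)"
    using z by (simp add: dir_deriv_sum dir_deriv_mult diff_dL dsp sum.distrib)
  moreover have "(\<Sum>k\<in>UNIV. partial_y i (partial_y k L) z * spray_vector L k z) =
      2 * spray_covector L i z"
    unfolding g_spray_vector[OF z, symmetric] sum_distrib_left by (simp add: g_nth)
  moreover have "(\<Sum>k\<in>UNIV. partial_y k L z * partial_y i (spray_vector L k) z) =
      4 * (\<Sum>k\<in>UNIV. canonical_N L k i z * partial_y k L z)"
    unfolding sum_distrib_left by (simp add: canonical_N_spray mult.commute)
  moreover have "partial_y i (\<lambda>z. 2 * (\<Sum>m\<in>UNIV. snd z $ m * partial_x m L z)) z =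
      2 * (partial_x i L z + (\<Sum>m\<in>UNIV. snd z $ m * partial_x m (partial_y i L) z))"
    using z by (simp add: dir_deriv_cmult dir_deriv_sum dir_deriv_mult diff_dL sum.distrib
        differentiable_sum_fun commute_L[of z "(0, axis i 1)"])
  \<comment> \<open>Unfolding the spray covector, the mixed second derivatives cancel between the
    two sides, and four times each side of the goal remains.\<close>
  ultimately show ?thesis by (simp add: spray_covector_def)
qed

text \<open>Linearity along the single fibre over \<open>z\<close> is enough: a
  \<open>y\<close>-derivative reads \<open>G\<close> off as the Berwald symbols, which are
  symmetric, and \<open>horizontal_deriv_L\<close> is then already the compatibility
  identity.\<close>

lemma berwald_imp_symmetric_compatible:
  assumes z: "z \<in> S"
    and N: "\<And>w k i. w \<in> S \<Longrightarrow> fst w = fst z \<Longrightarrow>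
      canonical_N L k i w = (\<Sum>j\<in>UNIV. G $ k $ i $ j * snd w $ j)"
  shows "symmetric_symbols G" "compatible_over S L (fst z) G" "berwald_symbol L k i j z = G $ k $ i $ j"
proof -
  have B: "berwald_symbol L k i j z = G $ k $ i $ j" for k i j
  proof -
    have "berwald_symbol L k i j z = partial_y j (\<lambda>w. \<Sum>s\<in>UNIV. G $ k $ i $ s * snd w $ s) z"
      unfolding berwald_symbol_def
      by (rule dir_deriv_slice[OF open_S z])
         (auto simp: N differentiable_sum_fun intro: smooth_on_differentiable[OF smooth_canonical_N z])
    then show ?thesis by (simp add: dir_deriv_sum dir_deriv_cmult)
  qed
  show "berwald_symbol L k i j z = G $ k $ i $ j" by (rule B)
  show "symmetric_symbols G"
    unfolding symmetric_symbols_def using B berwald_symbol_sym[OF z] by metis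
  show "compatible_over S L (fst z) G"
    unfolding compatible_over_def using N horizontal_deriv_L by auto
qed

text \<open>As a function on \<open>S\<close>, \<Gamma> coincides with the Berwald symbols, which
  inherit smoothness from \<open>L\<close>; being independent of \<open>y\<close>, it is smooth on
  the projection too.\<close>

lemma smooth_berwald_connection:
  assumes N: "\<And>z k i. z \<in> S \<Longrightarrow>
    canonical_N L k i z = (\<Sum>j\<in>UNIV. \<Gamma> (fst z) $ k $ i $ j * snd z $ j)"
  shows "smooth_on \<Gamma> (fst ` S)"
proof (rule smooth_on_fst_descend[OF open_S])
  have "smooth_on (\<lambda>z. \<Gamma> (fst z) $ k $ i $ j) S" for k i j
  proof (rule smooth_on_cong[OF open_S _ smooth_berwald_symbol])
    show "berwald_symbol L k i j z = \<Gamma> (fst z) $ k $ i $ j" if "z \<in> S" for z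
      by (rule berwald_imp_symmetric_compatible(3)[OF that]) (simp add: N)
  qed
  then show "smooth_on (\<lambda>z. \<Gamma> (fst z)) S"
    by (simp add: smooth_on_nth3[OF open_S])
qed

section \<open>Symmetric symbols compatible with \<open>L\<close> along one fibre\<close>

context
  fixes z :: "(real^'n) \<times> (real^'n)" and G :: "real^'n^'n^'n"
  assumes z: "z \<in> S" and sym: "symmetric_symbols G" and compat: "compatible_over S L (fst z) G"
begin

lemma G_sym: "G $ j $ i $ k = G $ j $ k $ i"
  using sym by (simp add: symmetric_symbols_def)

lemma partial_y_compatible:
  assumes w: "w \<in> S" "fst w = fst z"
  shows "partial_y l (partial_x i L) w = (\<Sum>j\<in>UNIV. G $ j $ i $ l * partial_y j L w +
    (\<Sum>k\<in>UNIV. G $ j $ i $ k * snd w $ k) * partial_y l (partial_y j L) w)"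
proof -
  have "partial_y l (partial_x i L) w =
    partial_y l (\<lambda>w. \<Sum>j\<in>UNIV. (\<Sum>k\<in>UNIV. G $ j $ i $ k * snd w $ k) * partial_y j L w) w"
    by (rule dir_deriv_slice[OF open_S w(1)])
       (use w compat in \<open>auto simp: compatible_over_def diff_dL intro!: differentiable_sum_fun\<close>)
  then show ?thesis
    using w by (simp add: dir_deriv_sum dir_deriv_mult dir_deriv_cmult diff_dL differentiable_sum_fun)
qed

text \<open>After exchanging the mixed derivatives, \<open>partial_y l\<close> falls either on the
  explicit \<open>y\<close> or on \<open>partial_y j L\<close>. By symmetry of \<open>G\<close> and
  compatibility the first contribution is \<open>partial_x l L\<close>, which cancels the last term
  of the spray covector; the second is the fundamental tensor applied to the claimed spray.\<close>

lemma spray_covector_compatible: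
  assumes w: "w \<in> S" "fst w = fst z"
  shows "spray_covector L l w =
    (\<Sum>j\<in>UNIV. g w $ l $ j * (2 * (\<Sum>m\<in>UNIV. \<Sum>k\<in>UNIV. G $ j $ m $ k * snd w $ m * snd w $ k)))"
proof -
  have "spray_covector L l w =
      (\<Sum>m\<in>UNIV. snd w $ m * partial_y l (partial_x m L) w) - partial_x l L w"
    unfolding spray_covector_def using commute_L[OF w(1)] by simp
  also have "(\<Sum>m\<in>UNIV. snd w $ m * partial_y l (partial_x m L) w) =
      (\<Sum>m\<in>UNIV. \<Sum>j\<in>UNIV. G $ j $ l $ m * snd w $ m * partial_y j L w) +
      (\<Sum>m\<in>UNIV. \<Sum>j\<in>UNIV. \<Sum>k\<in>UNIV. G $ j $ m $ k * snd w $ m * snd w $ k * (2 * g w $ l $ j))"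
    unfolding partial_y_compatible[OF w] g_nth
    by (simp add: sum_distrib_left sum_distrib_right sum.distrib algebra_simps G_sym[of _ _ l])
  also have "(\<Sum>m\<in>UNIV. \<Sum>j\<in>UNIV. G $ j $ l $ m * snd w $ m * partial_y j L w) = partial_x l L w"
    using compat w by (subst sum.swap) (simp add: compatible_over_def sum_distrib_right)
  finally have "spray_covector L l w =
      (\<Sum>m\<in>UNIV. \<Sum>j\<in>UNIV. \<Sum>k\<in>UNIV. G $ j $ m $ k * snd w $ m * snd w $ k * (2 * g w $ l $ j))"
    by simp
  also have "\<dots> = (\<Sum>j\<in>UNIV. \<Sum>m\<in>UNIV. \<Sum>k\<in>UNIV. G $ j $ m $ k * snd w $ m * snd w $ k * (2 * g w $ l $ j))"
    by (rule sum.swap)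
  finally show ?thesis
    by (simp add: sum_distrib_left sum_distrib_right mult_ac)
qed

lemma spray_vector_compatible:
  assumes w: "w \<in> S" "fst w = fst z"
  shows "spray_vector L j w = 2 * (\<Sum>m\<in>UNIV. \<Sum>k\<in>UNIV. G $ j $ m $ k * snd w $ m * snd w $ k)"
proof -
  let ?q = "\<chi> j. 2 * (\<Sum>m\<in>UNIV. \<Sum>k\<in>UNIV. G $ j $ m $ k * snd w $ m * snd w $ k)"
  have "(\<chi> l. spray_covector L l w) = g w *v ?q"
    by (simp add: vec_eq_iff matrix_vector_mult_def spray_covector_compatible[OF w])
  then have "matrix_inv (g w) *v (\<chi> l. spray_covector L l w) = ?q"
    by (simp add: matrix_vector_mul_assoc matrix_inv_mult nondegenerate w)
  then have "(matrix_inv (g w) *v (\<chi> l. spray_covector L l w)) $ j = ?q $ j"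
    by simp
  then show ?thesis by (simp add: matrix_vector_mult_def spray_vector_def)
qed

lemma canonical_N_compatible:
  assumes w: "w \<in> S" "fst w = fst z"
  shows "canonical_N L j i w = (\<Sum>k\<in>UNIV. G $ j $ i $ k * snd w $ k)"
proof -
  have "partial_y i (spray_vector L j) w =
    partial_y i (\<lambda>w. 2 * (\<Sum>m\<in>UNIV. \<Sum>k\<in>UNIV. G $ j $ m $ k * snd w $ m * snd w $ k)) w"
    by (rule dir_deriv_slice[OF open_S w(1)])
       (use w in \<open>auto simp: spray_vector_compatible
          intro!: differentiable_sum_fun smooth_on_differentiable[OF smooth_spray_vector]\<close>)
  also have "\<dots> = 2 * ((\<Sum>m\<in>UNIV. \<Sum>k\<in>UNIV. axis i 1 $ m * (G $ j $ m $ k * snd w $ k)) +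
      (\<Sum>m\<in>UNIV. \<Sum>k\<in>UNIV. axis i 1 $ k * (G $ j $ m $ k * snd w $ m)))"
    by (simp add: dir_deriv_cmult dir_deriv_sum dir_deriv_mult differentiable_sum_fun
        sum.distrib algebra_simps)
  \<comment> \<open>Symmetry of \<open>G\<close> makes the two Leibniz terms equal; with the 2 from
    the spray this yields the 4 that the 1/4 in \<open>canonical_N\<close> removes.\<close>
  also have "\<dots> = 4 * (\<Sum>k\<in>UNIV. G $ j $ i $ k * snd w $ k)"
    by (simp add: sum_distrib_left[symmetric] G_sym[of _ _ i])
  finally show ?thesis by (simp add: canonical_N_spray)
qed

lemma berwald_symbol_compatible: "berwald_symbol L k i j z = G $ k $ i $ j"
  by (rule berwald_imp_symmetric_compatible(3)[OF z canonical_N_compatible])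

text \<open>Differentiating the compatibility identity twice more in \<open>y\<close> leaves one
  term with a third derivative of \<open>L\<close>. It is exactly the vertical part that
  \<open>horizontal_deriv\<close> subtracts, so only metric compatibility in the classical form
  remains.\<close>

lemma horizontal_deriv_g:
  "horizontal_deriv (canonical_N L) i (\<lambda>w. g w $ l $ j) z =
    (\<Sum>m\<in>UNIV. G $ m $ i $ j * g z $ l $ m) + (\<Sum>m\<in>UNIV. G $ m $ i $ l * g z $ j $ m)"
proof -
  have dg: "dir_deriv v (\<lambda>w. g w $ l $ j) z = 1/2 * dir_deriv v (partial_y l (partial_y j L)) z" for v
    unfolding g_nth by (rule dir_deriv_cmult[OF diff_ddL[OF z]])
  have "partial_x i (partial_y l (partial_y j L)) z = partial_y l (partial_y j (partial_x i L)) z"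
    by (rule commute_dL[OF z])
  also have "\<dots> = partial_y l (\<lambda>w. \<Sum>m\<in>UNIV. G $ m $ i $ j * partial_y m L w +
      (\<Sum>k\<in>UNIV. G $ m $ i $ k * snd w $ k) * partial_y j (partial_y m L) w) z"
    by (rule dir_deriv_slice[OF open_S z])
       (use z in \<open>auto simp: partial_y_compatible diff_dL diff_ddL intro!: differentiable_sum_fun\<close>)
  also have "\<dots> = (\<Sum>m\<in>UNIV. G $ m $ i $ j * partial_y l (partial_y m L) z +
      (G $ m $ i $ l * partial_y j (partial_y m L) z +
       (\<Sum>k\<in>UNIV. G $ m $ i $ k * snd z $ k) * partial_y l (partial_y j (partial_y m L)) z))"
    using z by (simp add: dir_deriv_sum dir_deriv_add dir_deriv_mult dir_deriv_cmult diff_dL diff_ddL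
        differentiable_sum_fun)
  also have "\<dots> = (\<Sum>m\<in>UNIV. G $ m $ i $ j * partial_y l (partial_y m L) z +
      (G $ m $ i $ l * partial_y j (partial_y m L) z +
       canonical_N L m i z * partial_y m (partial_y l (partial_y j L)) z))"
    using z by (simp add: canonical_N_compatible commute_dL[OF z])
  finally show ?thesis
    unfolding horizontal_deriv_def dg
    by (simp add: g_nth sum.distrib sum_distrib_left algebra_simps)
qed

lemma chern_rund_compatible: "chern_rund L k i j z = G $ k $ i $ j"
proof -
  \<comment> \<open>The Christoffel cancellation: of the six terms, four cancel in pairs by the
    symmetry of \<open>G\<close> and the other two coincide.\<close>
  have "horizontal_deriv (canonical_N L) i (\<lambda>w. g w $ l $ j) z
      + horizontal_deriv (canonical_N L) j (\<lambda>w. g w $ i $ l) z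
      - horizontal_deriv (canonical_N L) l (\<lambda>w. g w $ i $ j) z
      = 2 * (\<Sum>m\<in>UNIV. g z $ l $ m * G $ m $ i $ j)" for l
    unfolding horizontal_deriv_g G_sym[of _ j i] G_sym[of _ l] by (simp add: mult.commute)
  then have "chern_rund L k i j z =
      (\<Sum>l\<in>UNIV. matrix_inv (g z) $ k $ l * (\<Sum>m\<in>UNIV. g z $ l $ m * G $ m $ i $ j))"
    by (simp add: chern_rund_def sum_distrib_left)
  also have "\<dots> = (matrix_inv (g z) *v (g z *v (\<chi> m. G $ m $ i $ j))) $ k"
    by (simp add: matrix_vector_mult_def)
  also have "\<dots> = G $ k $ i $ j"
    by (simp add: matrix_vector_mul_assoc matrix_inv_mult nondegenerate z)
  finally show ?thesis .
qed

end

lemma compatible_unique: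
  assumes "z \<in> S" "symmetric_symbols G" "compatible_over S L (fst z) G"
    and "symmetric_symbols G'" "compatible_over S L (fst z) G'"
  shows "G = G'"
  using berwald_symbol_compatible[OF assms(1-3)] berwald_symbol_compatible[OF assms(1,4,5)]
  by (simp add: vec_eq_iff)

end

section \<open>The quadratic form of a metric as a Lagrangian\<close>

locale metric_chart =
  fixes U :: "(real^'n::finite) set"
    and a :: "('m, 'n) field2"
    and c :: "('m, 'n) chart"
  assumes open_U: "open U"
    and smooth_a: "smooth_on (a c) U"
    and symmetric_a: "x \<in> U \<Longrightarrow> transpose (a c x) = a c x"
    and invertible_a: "x \<in> U \<Longrightarrow> invertible (a c x)"
begin

abbreviation A :: "(real^'n) \<times> (real^'n) \<Rightarrow> real"
  where "A \<equiv> \<lambda>z. quad_form (a c (fst z)) (snd z)"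

lemma a_sym: "x \<in> U \<Longrightarrow> a c x $ i $ j = a c x $ j $ i"
  using symmetric_a[of x] by (auto simp: transpose_def vec_eq_iff)

lemma smooth_a_nth: "smooth_on (\<lambda>x. a c x $ i $ j) U"
  by (intro smooth_on_nth open_U smooth_a)

lemma diff_a: "x \<in> U \<Longrightarrow> (\<lambda>x. a c x $ i $ j) differentiable (at x)"
  by (rule smooth_on_differentiable[OF smooth_a_nth])

lemma diff_a_fst:
  assumes "fst z \<in> U"
  shows "(\<lambda>z::(real^'n) \<times> (real^'n). a c (fst z) $ i $ j) differentiable (at z)"
  using smooth_on_differentiable[OF smooth_on_compose_fst[OF open_U smooth_a_nth], of z] assms
  by (simp add: mem_Times_iff)

lemma dir_deriv_a_fst:
  assumes "fst z \<in> U"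
  shows "dir_deriv w (\<lambda>z::(real^'n) \<times> (real^'n). a c (fst z) $ i $ j) z =
    dir_deriv (fst w) (\<lambda>x. a c x $ i $ j) (fst z)"
proof -
  have f: "fst differentiable (at z)"
    by (rule bounded_linear_imp_differentiable[OF bounded_linear_fst])
  show ?thesis
    using dir_deriv_chain[OF f, of "\<lambda>x. a c x $ i $ j" w] diff_a[OF assms]
    by (simp add: dir_deriv_bounded_linear[OF bounded_linear_fst])
qed

lemma smooth_A: "smooth_on A (U \<times> UNIV)"
  unfolding quad_form_def
  by (intro smooth_on_sum smooth_on_mult smooth_on_snd_nth
      smooth_on_compose_fst[OF open_U smooth_a_nth] open_Times open_U open_UNIV)

lemma dir_deriv_A:
  assumes "fst z \<in> U"
  shows "dir_deriv w A z =
    (\<Sum>p\<in>UNIV. \<Sum>q\<in>UNIV. dir_deriv (fst w) (\<lambda>x. a c x $ p $ q) (fst z) * snd z $ p * snd z $ q) +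
    (\<Sum>p\<in>UNIV. snd w $ p * (2 * (\<Sum>q\<in>UNIV. a c (fst z) $ p $ q * snd z $ q)))"
proof -
  have "dir_deriv w A z =
    (\<Sum>p\<in>UNIV. \<Sum>q\<in>UNIV. dir_deriv (fst w) (\<lambda>x. a c x $ p $ q) (fst z) * snd z $ p * snd z $ q) +
    ((\<Sum>p\<in>UNIV. \<Sum>q\<in>UNIV. snd w $ p * (a c (fst z) $ p $ q * snd z $ q)) +
     (\<Sum>p\<in>UNIV. \<Sum>q\<in>UNIV. snd w $ q * (a c (fst z) $ p $ q * snd z $ p)))"
    unfolding quad_form_def using assms
    by (simp add: dir_deriv_sum dir_deriv_mult differentiable_sum_fun diff_a_fst dir_deriv_a_fst
        sum.distrib algebra_simps)
  also have "(\<Sum>p\<in>UNIV. \<Sum>q\<in>UNIV. snd w $ q * (a c (fst z) $ p $ q * snd z $ p)) =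
      (\<Sum>p\<in>UNIV. \<Sum>q\<in>UNIV. snd w $ p * (a c (fst z) $ p $ q * snd z $ q))"
    by (subst sum.swap) (simp add: a_sym[OF assms])
  finally show ?thesis
    by (simp add: sum_distrib_left mult.left_commute)
qed

lemma partial_y_A:
  "fst z \<in> U \<Longrightarrow> partial_y j A z = 2 * (\<Sum>q\<in>UNIV. a c (fst z) $ j $ q * snd z $ q)"
  by (simp add: dir_deriv_A dir_deriv_zero diff_a)

lemma partial_x_A:
  "fst z \<in> U \<Longrightarrow> partial_x i A z =
    (\<Sum>p\<in>UNIV. \<Sum>q\<in>UNIV. partial i (\<lambda>x. a c x $ p $ q) (fst z) * snd z $ p * snd z $ q)"
  by (simp add: dir_deriv_A)

lemma fundamental_tensor_A:
  assumes "fst z \<in> U"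
  shows "fundamental_tensor A z = a c (fst z)"
proof -
  have "partial_y i (partial_y j A) z = 2 * a c (fst z) $ i $ j" for i j
  proof -
    have "partial_y i (partial_y j A) z =
        partial_y i (\<lambda>z. 2 * (\<Sum>q\<in>UNIV. a c (fst z) $ j $ q * snd z $ q)) z"
      by (rule dir_deriv_cong_open[of "U \<times> UNIV"])
         (use assms open_U in \<open>auto simp: partial_y_A open_Times mem_Times_iff\<close>)
    also have "\<dots> = 2 * (\<Sum>q\<in>UNIV. dir_deriv 0 (\<lambda>x. a c x $ j $ q) (fst z) * snd z $ q +
        axis i 1 $ q * a c (fst z) $ j $ q)"
      using assms
      by (simp add: dir_deriv_cmult dir_deriv_sum dir_deriv_mult differentiable_sum_fun diff_a_fst
          dir_deriv_a_fst mult.commute add.commute)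
    also have "\<dots> = 2 * a c (fst z) $ i $ j"
      by (simp add: sum.distrib a_sym[OF assms, of i] dir_deriv_zero diff_a assms)
    finally show ?thesis .
  qed
  then show ?thesis by (simp add: fundamental_tensor_def vec_eq_iff)
qed

text \<open>Null vectors and the zero section may be included: the fundamental tensor is
  \<open>a\<close> itself, which is invertible over all of \<open>U\<close> even where the quadratic
  form vanishes.\<close>

lemma finsler_chart_A: "finsler_chart (U \<times> UNIV) A"
proof
  show "quad_form (a c (fst (fst z, t *\<^sub>R snd z))) (snd (fst z, t *\<^sub>R snd z)) = t\<^sup>2 * A z" for z t
    by (simp add: quad_form_def sum_distrib_left power2_eq_square mult_ac)
qed (use open_U smooth_A invertible_a in \<open>auto simp: open_Times fundamental_tensor_A\<close>)

lemma symmetric_levi_civita: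
  assumes "x \<in> U"
  shows "symmetric_symbols (levi_civita a c x)"
proof -
  have "partial i (\<lambda>x. a c x $ p $ q) x = partial i (\<lambda>x. a c x $ q $ p) x" for i p q
    by (rule dir_deriv_cong_open[OF open_U assms a_sym])
  then show ?thesis
    by (simp add: symmetric_symbols_def levi_civita_def add.commute)
qed

lemma levi_civita_lower:
  assumes "x \<in> U"
  shows "(\<Sum>j\<in>UNIV. a c x $ q $ j * levi_civita a c x $ j $ i $ k) =
    1/2 * (partial i (\<lambda>x. a c x $ q $ k) x + partial k (\<lambda>x. a c x $ i $ q) x
       - partial q (\<lambda>x. a c x $ i $ k) x)"
proof -
  let ?w = "\<chi> l. partial i (\<lambda>x. a c x $ l $ k) x + partial k (\<lambda>x. a c x $ i $ l) x
       - partial l (\<lambda>x. a c x $ i $ k) x"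
  have "(\<Sum>j\<in>UNIV. a c x $ q $ j * levi_civita a c x $ j $ i $ k) =
      1/2 * (a c x *v (matrix_inv (a c x) *v ?w)) $ q"
    by (simp add: matrix_vector_mult_def levi_civita_def sum_distrib_left)
  also have "\<dots> = 1/2 * ?w $ q"
    by (simp add: matrix_vector_mul_assoc matrix_inv_mult invertible_a assms)
  finally show ?thesis by simp
qed

lemma compatible_levi_civita:
  assumes "x \<in> U"
  shows "compatible_over (U \<times> UNIV) A x (levi_civita a c x)"
  unfolding compatible_over_def
proof (intro ballI impI allI)
  fix w :: "(real^'n) \<times> (real^'n)" and i
  assume w: "w \<in> U \<times> UNIV" "fst w = x"
  let ?D = "\<lambda>i p q. partial i (\<lambda>x. a c x $ p $ q) x"
  let ?y = "snd w"
  have D: "?D i p q = ?D i q p" for i p q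
    by (rule dir_deriv_cong_open[OF open_U assms a_sym])
  have "(\<Sum>j\<in>UNIV. (\<Sum>k\<in>UNIV. levi_civita a c x $ j $ i $ k * ?y $ k) * partial_y j A w) =
      (\<Sum>j\<in>UNIV. \<Sum>k\<in>UNIV. \<Sum>q\<in>UNIV.
        2 * ?y $ k * ?y $ q * (a c x $ q $ j * levi_civita a c x $ j $ i $ k))"
  proof (rule sum.cong[OF refl])
    fix j
    have "partial_y j A w = (\<Sum>q\<in>UNIV. 2 * (a c x $ q $ j * ?y $ q))"
      using w assms by (simp add: partial_y_A sum_distrib_left a_sym[OF assms, of j])
    then show "(\<Sum>k\<in>UNIV. levi_civita a c x $ j $ i $ k * ?y $ k) * partial_y j A w =
        (\<Sum>k\<in>UNIV. \<Sum>q\<in>UNIV. 2 * ?y $ k * ?y $ q * (a c x $ q $ j * levi_civita a c x $ j $ i $ k))"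
      by (simp only: sum_product mult_ac)
  qed
  also have "\<dots> = (\<Sum>k\<in>UNIV. \<Sum>q\<in>UNIV. \<Sum>j\<in>UNIV.
        2 * ?y $ k * ?y $ q * (a c x $ q $ j * levi_civita a c x $ j $ i $ k))"
    by (subst sum.swap, rule sum.cong[OF refl], rule sum.swap)
  also have "\<dots> = (\<Sum>k\<in>UNIV. \<Sum>q\<in>UNIV. ?y $ k * ?y $ q * (?D i q k + ?D k i q - ?D q i k))"
    unfolding sum_distrib_left[symmetric] levi_civita_lower[OF assms] by (simp add: mult.assoc)
  also have "\<dots> = (\<Sum>k\<in>UNIV. \<Sum>q\<in>UNIV. ?y $ k * ?y $ q * ?D i q k) +
      ((\<Sum>k\<in>UNIV. \<Sum>q\<in>UNIV. ?y $ k * ?y $ q * ?D k i q) -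
       (\<Sum>k\<in>UNIV. \<Sum>q\<in>UNIV. ?y $ k * ?y $ q * ?D q i k))"
    by (simp add: algebra_simps sum.distrib sum_subtractf)
  \<comment> \<open>The contraction with the symmetric product of \<open>y\<close> with itself
    identifies the last two sums, and only the derivative of \<open>a\<close> in direction
    \<open>i\<close> survives.\<close>
  also have "(\<Sum>k\<in>UNIV. \<Sum>q\<in>UNIV. ?y $ k * ?y $ q * ?D q i k) =
      (\<Sum>k\<in>UNIV. \<Sum>q\<in>UNIV. ?y $ k * ?y $ q * ?D k i q)"
    by (subst sum.swap) (simp add: mult_ac)
  finally show "partial_x i A w =
      (\<Sum>j\<in>UNIV. (\<Sum>k\<in>UNIV. levi_civita a c x $ j $ i $ k * ?y $ k) * partial_y j A w)"
    using w assms by (simp add: partial_x_A mult_ac D)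
qed

lemma smooth_levi_civita: "smooth_on (levi_civita a c) U"
  unfolding smooth_on_nth3[OF open_U] levi_civita_def
  by (unfold vec_lambda_beta, intro allI smooth_on_sum smooth_on_mult smooth_on_diff smooth_on_add smooth_on_const
      smooth_on_matrix_inv smooth_on_dir_deriv smooth_a_nth open_U invertible_a)

text \<open>The Levi-Civita horizontal derivative annihilates \<open>A\<close>, so on
  \<open>L = \<omega> * A\<close> it acts on \<omega> alone. Adding \<open>T\<close> to the symbols
  subtracts precisely the right-hand side of the deformation equation.\<close>

lemma deformation_iff_compatible:
  assumes z: "z \<in> S" "fst z \<in> U" and S: "open S"
    and L: "\<And>w. w \<in> S \<Longrightarrow> L w = \<omega> w * A w" and \<omega>: "\<omega> differentiable (at z)"
  shows "A z * horizontal_deriv (linear_N (levi_civita a c)) i \<omega> z =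
      (\<Sum>j\<in>UNIV. \<Sum>k\<in>UNIV. T $ j $ i $ k * snd z $ k * partial_y j L z) \<longleftrightarrow>
    partial_x i L z =
      (\<Sum>j\<in>UNIV. (\<Sum>k\<in>UNIV. (levi_civita a c (fst z) + T) $ j $ i $ k * snd z $ k) * partial_y j L z)"
proof -
  let ?N = "linear_N (levi_civita a c)"
  have dA: "A differentiable (at z)"
    using smooth_on_differentiable[OF smooth_A, of z] z by (simp add: mem_Times_iff)
  have dL: "dir_deriv v L z = dir_deriv v \<omega> z * A z + \<omega> z * dir_deriv v A z" for v
    using dir_deriv_cong_open[OF S z(1) L] dir_deriv_mult[OF \<omega> dA] by simp
  have hA: "partial_x i A z = (\<Sum>j\<in>UNIV. ?N j i z * partial_y j A z)"
    using compatible_levi_civita[OF z(2), unfolded compatible_over_def, rule_format, of z i] z(2)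
    by (simp add: linear_N_def mem_Times_iff)
  have "horizontal_deriv ?N i L z = A z * horizontal_deriv ?N i \<omega> z"
    unfolding horizontal_deriv_def dL hA
    by (simp add: algebra_simps sum.distrib sum_distrib_left)
  moreover have "(\<Sum>j\<in>UNIV. (\<Sum>k\<in>UNIV. (levi_civita a c (fst z) + T) $ j $ i $ k * snd z $ k) * partial_y j L z) =
      (\<Sum>j\<in>UNIV. ?N j i z * partial_y j L z) +
      (\<Sum>j\<in>UNIV. \<Sum>k\<in>UNIV. T $ j $ i $ k * snd z $ k * partial_y j L z)"
    by (simp add: linear_N_def algebra_simps sum.distrib sum_distrib_left)
  ultimately show ?thesis
    by (auto simp: horizontal_deriv_def)
qed

end

section \<open>Change of coordinates\<close>

text \<open>The connection law at one point: \<open>\<phi>\<close> gives the old coordinates in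
  terms of the new ones, \<open>x\<close> is the point in new coordinates, and \<open>J\<close>
  stands for the Jacobian from old to new.\<close>

definition transform_symbols ::
    "(real^'n::finite \<Rightarrow> real^'n) \<Rightarrow> real^'n^'n \<Rightarrow> real^'n \<Rightarrow> real^'n^'n^'n \<Rightarrow> real^'n^'n^'n"
  where "transform_symbols \<phi> J x G = (\<chi> r s t.
    (\<Sum>j\<in>UNIV. \<Sum>i\<in>UNIV. \<Sum>k\<in>UNIV. J $ r $ j * G $ j $ i $ k *
       jacobian \<phi> (at x) $ i $ s * jacobian \<phi> (at x) $ k $ t) +
    (\<Sum>j\<in>UNIV. J $ r $ j * partial s (partial t (\<lambda>x'. \<phi> x' $ j)) x))"

lemma jacobian_nth:
  fixes \<phi> :: "real^'n::finite \<Rightarrow> real^'m"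
  assumes "\<phi> differentiable (at x)"
  shows "jacobian \<phi> (at x) $ j $ i = partial i (\<lambda>x. \<phi> x $ j) x"
  using dir_deriv_nth[OF assms] by (simp add: jacobian_def matrix_def dir_deriv_def)

lemma symmetric_transform_symbols:
  assumes V: "open V" "x \<in> V" and \<phi>: "smooth_on \<phi> V" and G: "symmetric_symbols G"
  shows "symmetric_symbols (transform_symbols \<phi> J x G)"
proof -
  have "partial s (partial t (\<lambda>x'. \<phi> x' $ j)) x = partial t (partial s (\<lambda>x'. \<phi> x' $ j)) x" for s t j
    by (rule dir_deriv_commute[OF V smooth_on_nth[OF V(1) \<phi>]])
  moreover have "(\<Sum>i\<in>UNIV. \<Sum>k\<in>UNIV. J $ r $ j * G $ j $ i $ k *
       jacobian \<phi> (at x) $ i $ s * jacobian \<phi> (at x) $ k $ t) =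
      (\<Sum>i\<in>UNIV. \<Sum>k\<in>UNIV. J $ r $ j * G $ j $ i $ k *
       jacobian \<phi> (at x) $ i $ t * jacobian \<phi> (at x) $ k $ s)" for r j s t
    using G by (subst sum.swap) (simp add: symmetric_symbols_def mult_ac)
  ultimately show ?thesis
    by (simp add: symmetric_symbols_def transform_symbols_def)
qed

text \<open>The induced map on tangent vectors is linear in \<open>y\<close> with coefficients
  depending on \<open>x\<close>. An \<open>x\<close>-derivative of \<open>L'\<close> therefore picks
  up second derivatives of \<open>\<phi>\<close> against the \<open>y\<close>-gradient of
  \<open>L\<close>, and these form the inhomogeneous term of the connection law.\<close>

lemma compatible_transform_symbols:
  fixes \<phi> :: "real^'n::finite \<Rightarrow> real^'n"
  assumes V: "open V" "x \<in> V" and \<phi>: "smooth_on \<phi> V"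
    and J: "jacobian \<phi> (at x) ** J = mat 1"
    and L: "\<And>w. w \<in> S \<Longrightarrow> L differentiable (at w)"
    and S': "open S'"
    and rel: "\<And>w. w \<in> S' \<Longrightarrow> fst w \<in> V \<Longrightarrow>
      (\<phi> (fst w), jacobian \<phi> (at (fst w)) *v snd w) \<in> S \<and>
      L' w = L (\<phi> (fst w), jacobian \<phi> (at (fst w)) *v snd w)"
    and G: "compatible_over S L (\<phi> x) G"
  shows "compatible_over S' L' x (transform_symbols \<phi> J x G)"
  unfolding compatible_over_def
proof (intro ballI impI allI)
  fix w i
  assume w: "w \<in> S'" "fst w = x"
  let ?y = "snd w"
  let ?B = "\<lambda>j i. partial i (\<lambda>x. \<phi> x $ j) x"
  let ?H = "\<lambda>j i s. partial i (partial s (\<lambda>x. \<phi> x $ j)) x"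
  \<comment> \<open>The Jacobian is written out in partial derivatives of the components, which are
    smooth functions on \<open>V\<close>; the two forms agree over \<open>V\<close>.\<close>
  let ?\<Phi> = "\<lambda>w::(real^'n) \<times> (real^'n). (\<phi> (fst w), (\<chi> j. \<Sum>s\<in>UNIV. partial s (\<lambda>x. \<phi> x $ j) (fst w) * snd w $ s))"
  have d\<phi>: "\<phi> differentiable (at u)" if "u \<in> V" for u
    by (rule smooth_on_differentiable[OF \<phi> that])
  have B: "jacobian \<phi> (at x) $ j $ i = ?B j i" for j i
    by (rule jacobian_nth[OF d\<phi>[OF V(2)]])
  have \<Phi>: "(\<phi> (fst w), jacobian \<phi> (at (fst w)) *v snd w) = ?\<Phi> w" if "fst w \<in> V" for w
    using that by (simp add: matrix_vector_mult_def vec_eq_iff jacobian_nth d\<phi>)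
  have f: "fst differentiable (at w)"
    by (rule bounded_linear_imp_differentiable[OF bounded_linear_fst])
  have dB: "partial s (\<lambda>x. \<phi> x $ j) differentiable (at x)" for s j
    by (rule smooth_on_differentiable[OF smooth_on_dir_deriv[OF smooth_on_nth[OF V(1) \<phi>]] V(2)])
  have dBf: "(\<lambda>w. partial s (\<lambda>x. \<phi> x $ j) (fst w)) differentiable (at w)" for s j
    using differentiable_compose[of "partial s (\<lambda>x. \<phi> x $ j)" fst w UNIV] f dB w(2) by simp
  have dY: "(\<lambda>w. \<Sum>s\<in>UNIV. partial s (\<lambda>x. \<phi> x $ j) (fst w) * snd w $ s) differentiable (at w)" for j
    by (intro differentiable_sum_fun differentiable_mult dBf) simp
  have dYv: "(\<lambda>w. \<chi> j. \<Sum>s\<in>UNIV. partial s (\<lambda>x. \<phi> x $ j) (fst w) * snd w $ s) differentiable (at w)"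
    by (rule differentiable_vec_componentwise) (simp add: dY)
  have d\<phi>f: "(\<lambda>w. \<phi> (fst w)) differentiable (at w)"
    using differentiable_compose[of \<phi> fst w UNIV] f d\<phi>[OF V(2)] w(2) by simp
  have DBf: "dir_deriv v (\<lambda>w. partial s (\<lambda>x. \<phi> x $ j) (fst w)) w =
      dir_deriv (fst v) (partial s (\<lambda>x. \<phi> x $ j)) x" for s j v
    using dir_deriv_chain[OF f, of "partial s (\<lambda>x. \<phi> x $ j)" v] dB w(2)
    by (simp add: dir_deriv_bounded_linear[OF bounded_linear_fst])
  have D1: "dir_deriv v (\<lambda>w. \<phi> (fst w)) w $ j = dir_deriv (fst v) (\<lambda>x. \<phi> x $ j) x" for v j
    using dir_deriv_chain[OF f, of \<phi> v] d\<phi>[OF V(2)] w(2)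
    by (simp add: dir_deriv_bounded_linear[OF bounded_linear_fst] dir_deriv_nth)
  have D2: "dir_deriv v (\<lambda>w. \<chi> j. \<Sum>s\<in>UNIV. partial s (\<lambda>x. \<phi> x $ j) (fst w) * snd w $ s) w $ j =
      (\<Sum>s\<in>UNIV. dir_deriv (fst v) (partial s (\<lambda>x. \<phi> x $ j)) x * ?y $ s + ?B j s * snd v $ s)" for v j
    unfolding dir_deriv_nth[OF dYv, symmetric]
    by (simp add: dir_deriv_sum dir_deriv_mult dBf DBf w(2))
  let ?z = "?\<Phi> w"
  have zS: "?z \<in> S"
    using rel[OF w(1)] \<Phi>[of w] w(2) V(2) by simp
  have "open (S' \<inter> fst -` V)"
    by (intro open_Int S' open_vimage V continuous_intros)
  then have chain: "dir_deriv v L' w = dir_deriv v (\<lambda>w. L (?\<Phi> w)) w" for v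
    by (rule dir_deriv_cong_open) (use w V rel \<Phi> in auto)
  have DL': "dir_deriv v L' w =
      (\<Sum>j\<in>UNIV. dir_deriv (fst v) (\<lambda>x. \<phi> x $ j) x * partial_x j L ?z) +
      (\<Sum>j\<in>UNIV. (\<Sum>s\<in>UNIV. dir_deriv (fst v) (partial s (\<lambda>x. \<phi> x $ j)) x * ?y $ s + ?B j s * snd v $ s)
         * partial_y j L ?z)" for v
  proof -
    have d\<Phi>: "?\<Phi> differentiable (at w)"
      by (intro differentiable_Pair d\<phi>f dYv)
    have d: "dir_deriv v ?\<Phi> w = (dir_deriv v (\<lambda>w. \<phi> (fst w)) w,
        dir_deriv v (\<lambda>w. \<chi> j. \<Sum>s\<in>UNIV. partial s (\<lambda>x. \<phi> x $ j) (fst w) * snd w $ s) w)"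
      by (rule dir_deriv_eq[OF has_derivative_Pair])
         (rule has_derivative_dir_deriv[OF d\<phi>f] has_derivative_dir_deriv[OF dYv])+
    have "dir_deriv v L' w = dir_deriv (dir_deriv v ?\<Phi> w) L ?z"
      unfolding chain by (rule dir_deriv_chain[OF d\<Phi> L[OF zS]])
    then show ?thesis
      unfolding d dir_deriv_partial_xy[OF L[OF zS], of "dir_deriv v (\<lambda>w. \<phi> (fst w)) w"] D1 D2 .
  qed
  have dy: "partial_y r L' w = (\<Sum>j\<in>UNIV. ?B j r * partial_y j L ?z)" for r
    unfolding DL'
    by (simp add: dir_deriv_zero dB differentiable_nth d\<phi>[OF V(2)])
  have JB: "(\<Sum>r\<in>UNIV. ?B j r * J $ r $ m) = (if j = m then 1 else 0)" for j m
    using arg_cong[OF J, of "\<lambda>M. M $ j $ m"] by (simp add: matrix_matrix_mult_def mat_def B)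
  \<comment> \<open>\<open>J\<close> inverts the Jacobian, so the old vertical derivatives can be
    expressed through the new ones.\<close>
  have inv: "partial_y m L ?z = (\<Sum>r\<in>UNIV. J $ r $ m * partial_y r L' w)" for m
  proof -
    have "(\<Sum>r\<in>UNIV. J $ r $ m * partial_y r L' w) =
        (\<Sum>j\<in>UNIV. (\<Sum>r\<in>UNIV. ?B j r * J $ r $ m) * partial_y j L ?z)"
      unfolding dy sum_distrib_left sum_distrib_right by (subst sum.swap) (simp add: mult_ac)
    then show ?thesis by (simp add: JB if_distrib if_distribR cong: if_cong)
  qed
  \<comment> \<open>The transformed symbols with their upper index still in the old coordinates;
    contracting \<open>m\<close> with \<open>J\<close> completes the law.\<close>
  let ?W = "\<lambda>m s. (\<Sum>j\<in>UNIV. \<Sum>k\<in>UNIV. G $ m $ j $ k * ?B j i * ?B k s) + ?H m i s"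
  have cz: "partial_x j L ?z = (\<Sum>m\<in>UNIV. (\<Sum>k\<in>UNIV. G $ m $ j $ k * snd ?z $ k) * partial_y m L ?z)" for j
    using G zS w(2) unfolding compatible_over_def by auto
  have "partial_x i L' w = (\<Sum>j\<in>UNIV. ?B j i * partial_x j L ?z) +
      (\<Sum>m\<in>UNIV. (\<Sum>s\<in>UNIV. ?H m i s * ?y $ s) * partial_y m L ?z)"
    unfolding DL' by simp
  also have "(\<Sum>j\<in>UNIV. ?B j i * partial_x j L ?z) =
      (\<Sum>m\<in>UNIV. (\<Sum>s\<in>UNIV. (\<Sum>j\<in>UNIV. \<Sum>k\<in>UNIV. G $ m $ j $ k * ?B j i * ?B k s) * ?y $ s) * partial_y m L ?z)"
  proof -
    have "(\<Sum>s\<in>UNIV. (\<Sum>j\<in>UNIV. \<Sum>k\<in>UNIV. G $ m $ j $ k * ?B j i * ?B k s) * ?y $ s) =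
        (\<Sum>j\<in>UNIV. \<Sum>k\<in>UNIV. \<Sum>s\<in>UNIV. G $ m $ j $ k * ?B j i * ?B k s * ?y $ s)" for m
      unfolding sum_distrib_right by (subst sum.swap, rule sum.cong[OF refl], rule sum.swap)
    then have Y: "(\<Sum>s\<in>UNIV. (\<Sum>j\<in>UNIV. \<Sum>k\<in>UNIV. G $ m $ j $ k * ?B j i * ?B k s) * ?y $ s) =
        (\<Sum>j\<in>UNIV. ?B j i * (\<Sum>k\<in>UNIV. G $ m $ j $ k * snd ?z $ k))" for m
      by (simp add: w(2) sum_distrib_left mult_ac)
    have swap: "(\<Sum>j\<in>UNIV. b j * (\<Sum>m\<in>UNIV. C m j * P m)) = (\<Sum>m\<in>UNIV. (\<Sum>j\<in>UNIV. b j * C m j) * P m)"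
      for b P :: "'n \<Rightarrow> real" and C :: "'n \<Rightarrow> 'n \<Rightarrow> real"
      unfolding sum_distrib_left sum_distrib_right by (subst sum.swap) (simp add: mult_ac)
    show ?thesis
      unfolding cz Y by (rule swap)
  qed
  also have "\<dots> + (\<Sum>m\<in>UNIV. (\<Sum>s\<in>UNIV. ?H m i s * ?y $ s) * partial_y m L ?z) =
      (\<Sum>m\<in>UNIV. (\<Sum>s\<in>UNIV. ?W m s * ?y $ s) * partial_y m L ?z)"
    by (simp add: sum.distrib[symmetric] distrib_right[symmetric])
  also have "\<dots> = (\<Sum>m\<in>UNIV. \<Sum>r\<in>UNIV. \<Sum>s\<in>UNIV. J $ r $ m * ?W m s * ?y $ s * partial_y r L' w)"
  proof -
    have "(\<Sum>s\<in>UNIV. W s * y s) * (\<Sum>r\<in>UNIV. b r * P r) = (\<Sum>r\<in>UNIV. \<Sum>s\<in>UNIV. b r * W s * y s * P r)"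
      for W y b P :: "'n \<Rightarrow> real"
      unfolding sum_product by (subst sum.swap) (simp add: mult_ac)
    then show ?thesis unfolding inv by (intro sum.cong refl)
  qed
  also have "\<dots> = (\<Sum>r\<in>UNIV. \<Sum>s\<in>UNIV. \<Sum>m\<in>UNIV. J $ r $ m * ?W m s * ?y $ s * partial_y r L' w)"
    by (subst sum.swap, rule sum.cong[OF refl], rule sum.swap)
  also have "\<dots> = (\<Sum>r\<in>UNIV. (\<Sum>s\<in>UNIV. transform_symbols \<phi> J x G $ r $ i $ s * ?y $ s) * partial_y r L' w)"
    by (simp add: transform_symbols_def B sum_distrib_right sum_distrib_left distrib_left distrib_right sum.distrib mult.assoc)
  finally show "partial_x i L' w =
      (\<Sum>r\<in>UNIV. (\<Sum>s\<in>UNIV. transform_symbols \<phi> J x G $ r $ i $ s * ?y $ s) * partial_y r L' w)" .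
qed

section \<open>Lagrangians and connections on a manifold\<close>

lemma overlap_commute: "overlap c c' = overlap c' c"
  by (auto simp: overlap_def)

locale smooth_atlas =
  fixes X :: "'m topology" and atlas :: "('m, 'n::finite) chart set"
  assumes manifold: "smooth_manifold X atlas"
begin

lemma is_chart: "c \<in> atlas \<Longrightarrow> is_chart X c"
  using manifold by (simp add: smooth_manifold_def)

lemma open_chart_img: "c \<in> atlas \<Longrightarrow> open (chart_img c)"
  using is_chart by (simp add: is_chart_def)

lemma topspace_chart: "c \<in> atlas \<Longrightarrow> topspace (subtopology X (chart_dom c)) = chart_dom c"
  using is_chart[of c] openin_subset[of X "chart_dom c"] by (auto simp: is_chart_def)

lemma inj_coords:
  assumes "c \<in> atlas"
  shows "inj_on (coords c) (chart_dom c)"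
  using is_chart[OF assms] topspace_chart[OF assms] homeomorphic_imp_injective_map
  unfolding is_chart_def by metis

lemma open_overlap_img:
  assumes c: "c \<in> atlas" "c' \<in> atlas"
  shows "open (coords c ` overlap c c')"
proof -
  have "openin (subtopology X (chart_dom c)) (overlap c c')"
    using is_chart[OF c(2)] unfolding is_chart_def overlap_def
    by (metis openin_subtopology_Int2)
  moreover have "overlap c c' \<subseteq> topspace (subtopology X (chart_dom c))"
    using topspace_chart[OF c(1)] by (auto simp: overlap_def)
  ultimately have "openin (top_of_set (chart_img c)) (coords c ` overlap c c')"
    using is_chart[OF c(1)] homeomorphic_map_openness unfolding is_chart_def by metis
  then show ?thesis
    using open_chart_img[OF c(1)] openin_open_eq by blast
qed

lemma transition_coords:
  "c \<in> atlas \<Longrightarrow> p \<in> chart_dom c \<Longrightarrow> transition c c' (coords c p) = coords c' p"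
  by (simp add: transition_def inv_into_f_f inj_coords)

lemma smooth_transition:
  "c \<in> atlas \<Longrightarrow> c' \<in> atlas \<Longrightarrow> smooth_on (transition c c') (coords c ` overlap c c')"
  using manifold by (simp add: smooth_manifold_def)

text \<open>The chain rule, applied to the two transition maps, whose composition is the identity on
  the open image of the overlap.\<close>

lemma jac_inverse:
  assumes c: "c \<in> atlas" "c' \<in> atlas" and p: "p \<in> overlap c c'"
  shows "jac c' c (coords c' p) ** jac c c' (coords c p) = mat 1"
proof -
  let ?x = "coords c p" and ?\<phi> = "transition c c'" and ?\<psi> = "transition c' c"
  have \<phi>: "?\<phi> differentiable (at ?x)"
    by (rule smooth_on_differentiable[OF smooth_transition[OF c]]) (use p in simp)
  have \<phi>x: "?\<phi> ?x = coords c' p"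
    by (rule transition_coords[OF c(1)]) (use p in \<open>simp add: overlap_def\<close>)
  have \<psi>: "?\<psi> differentiable (at (?\<phi> ?x))"
    unfolding \<phi>x
    by (rule smooth_on_differentiable[OF smooth_transition[OF c(2,1)]]) (use p in \<open>simp add: overlap_commute[of c' c]\<close>)
  have "dir_deriv v (\<lambda>x. ?\<psi> (?\<phi> x)) ?x = v" for v
  proof -
    have "dir_deriv v (\<lambda>x. ?\<psi> (?\<phi> x)) ?x = dir_deriv v (\<lambda>x. x) ?x"
      by (rule dir_deriv_cong_open[OF open_overlap_img[OF c]])
         (use p c in \<open>auto simp: transition_coords overlap_def\<close>)
    then show ?thesis by (simp add: dir_deriv_def)
  qed
  then have id: "dir_deriv (dir_deriv v ?\<phi> ?x) ?\<psi> (?\<phi> ?x) = v" for v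
    by (simp add: dir_deriv_chain[OF \<phi> \<psi>])
  have "(jac c' c (coords c' p) ** jac c c' ?x) $ i $ j = mat 1 $ i $ j" for i j
  proof -
    have "(jac c' c (coords c' p) ** jac c c' ?x) $ i $ j =
        (\<Sum>k\<in>UNIV. dir_deriv (axis j 1) ?\<phi> ?x $ k * partial k (\<lambda>x. ?\<psi> x $ i) (?\<phi> ?x))"
      unfolding matrix_matrix_mult_def jac_def
      using \<phi> \<psi> by (simp add: jacobian_nth dir_deriv_nth \<phi>x mult.commute)
    also have "\<dots> = dir_deriv (dir_deriv (axis j 1) ?\<phi> ?x) (\<lambda>x. ?\<psi> x $ i) (?\<phi> ?x)"
      by (rule dir_deriv_partial[symmetric]) (rule differentiable_nth[OF \<psi>])
    also have "\<dots> = axis j 1 $ i"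
      by (simp only: dir_deriv_nth[OF \<psi>] id)
    finally show ?thesis by (auto simp: axis_def mat_def)
  qed
  then show ?thesis by (simp add: vec_eq_iff)
qed

text \<open>The components in \<open>c\<close> determine those in every other chart around the point
  through the Jacobians, and at all remaining arguments the default value 0 leaves no
  freedom.\<close>

lemma inj_tcoords:
  assumes c: "c \<in> atlas"
  shows "inj_on (tcoords c) (over (tangent_bundle atlas) c)"
proof (rule inj_onI)
  fix \<xi> \<eta>
  assume \<xi>: "\<xi> \<in> over (tangent_bundle atlas) c" and \<eta>: "\<eta> \<in> over (tangent_bundle atlas) c"
    and eq: "tcoords c \<xi> = tcoords c \<eta>"
  obtain p v q w where pv: "\<xi> = (p, v)" "\<eta> = (q, w)" by (cases \<xi>, cases \<eta>)
  have p: "p \<in> chart_dom c" "q \<in> chart_dom c" using \<xi> \<eta> by (auto simp: over_def pv)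
  have "q = p" and vw: "v c = w c"
    using eq p inj_onD[OF inj_coords[OF c]] by (auto simp: tcoords_def pv)
  have v: "(p, v) \<in> tangent_bundle atlas" and w: "(p, w) \<in> tangent_bundle atlas"
    using \<xi> \<eta> by (auto simp: over_def pv \<open>q = p\<close>)
  have "v c' = w c'" for c'
  proof (cases "c' \<in> atlas \<and> p \<in> chart_dom c'")
    case True
    then have "p \<in> overlap c c'" using p by (simp add: overlap_def)
    then have "v c' = jac c c' (coords c p) *v v c" "w c' = jac c c' (coords c p) *v w c"
      using v w c True unfolding tangent_bundle_def by blast+
    then show ?thesis using vw by simp
  next
    case False
    then have "v c' = 0" "w c' = 0"
      using v w unfolding tangent_bundle_def by blast+
    then show ?thesis by simp
  qed
  then show "\<xi> = \<eta>" by (auto simp: pv \<open>q = p\<close>)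
qed

text \<open>\<open>local_rep\<close> inverts \<open>tcoords c\<close> over the whole tangent bundle,
  so it returns to the given vector by injectivity there.\<close>

lemma local_rep_tcoords:
  assumes "c \<in> atlas" "\<A> \<subseteq> tangent_bundle atlas" "\<xi> \<in> over \<A> c"
  shows "local_rep atlas c F (tcoords c \<xi>) = F \<xi>"
proof -
  have "\<xi> \<in> over (tangent_bundle atlas) c" using assms(2,3) by (auto simp: over_def)
  then show ?thesis by (simp add: local_rep_def inv_into_f_f inj_tcoords assms(1))
qed

lemma local_rep_transition:
  assumes c: "c \<in> atlas" "c' \<in> atlas" and \<A>: "\<A> \<subseteq> tangent_bundle atlas"
    and w: "w \<in> local_set \<A> c'" "fst w \<in> coords c' ` overlap c c'"
  defines "w' \<equiv> (transition c' c (fst w), jac c' c (fst w) *v snd w)"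
  shows "w' \<in> local_set \<A> c" "local_rep atlas c' F w = local_rep atlas c F w'"
proof -
  obtain \<xi> where \<xi>: "\<xi> \<in> over \<A> c'" "w = tcoords c' \<xi>"
    using w(1) by (auto simp: local_set_def)
  obtain q where q: "q \<in> overlap c c'" "fst w = coords c' q"
    using w(2) by auto
  have "fst \<xi> = q"
    using inj_onD[OF inj_coords[OF c(2)], of "fst \<xi>" q] \<xi> q by (auto simp: tcoords_def over_def overlap_def)
  then have p: "fst \<xi> \<in> overlap c' c" using q by (simp add: overlap_commute[of c' c])
  have \<xi>c: "\<xi> \<in> over \<A> c" using \<xi> p by (auto simp: over_def overlap_def)
  have "(fst \<xi>, snd \<xi>) \<in> tangent_bundle atlas" using \<A> \<xi> by (auto simp: over_def)
  then have "snd \<xi> c = jac c' c (coords c' (fst \<xi>)) *v snd \<xi> c'"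
    using c p unfolding tangent_bundle_def by blast
  then have "tcoords c \<xi> = w'"
    using p c by (simp add: w'_def tcoords_def \<xi>(2) transition_coords overlap_def)
  then show "w' \<in> local_set \<A> c" "local_rep atlas c' F w = local_rep atlas c F w'"
    using \<xi>c \<xi> local_rep_tcoords[OF c(1) \<A> \<xi>c] local_rep_tcoords[OF c(2) \<A> \<xi>(1)]
    by (auto simp: local_set_def)
qed

lemma affine_connection_iff:
  "affine_connection atlas \<Gamma> \<longleftrightarrow>
    (\<forall>c\<in>atlas. smooth_on (\<Gamma> c) (chart_img c)) \<and>
    (\<forall>c\<in>atlas. \<forall>c'\<in>atlas. \<forall>p\<in>overlap c c'. \<Gamma> c' (coords c' p) =
      transform_symbols (transition c' c) (jac c c' (coords c p)) (coords c' p) (\<Gamma> c (coords c p)))"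
  by (simp add: affine_connection_def transform_symbols_def vec_eq_iff jac_def)

text \<open>In an overlap, the symbols of one chart, transformed to the other, are again symmetric and
  compatible, so uniqueness of such symbols replaces the second-order transformation of the spray.\<close>

lemma compatible_imp_affine_connection:
  fixes S :: "('m, 'n) chart \<Rightarrow> ((real^'n) \<times> (real^'n)) set"
  assumes chart: "\<And>c. c \<in> atlas \<Longrightarrow> finsler_chart (S c) (\<L> c)"
    and fst_S: "\<And>c. c \<in> atlas \<Longrightarrow> fst ` S c = chart_img c"
    and rel: "\<And>c c' w. c \<in> atlas \<Longrightarrow> c' \<in> atlas \<Longrightarrow> w \<in> S c' \<Longrightarrow> fst w \<in> coords c' ` overlap c c' \<Longrightarrow>
      (transition c' c (fst w), jac c' c (fst w) *v snd w) \<in> S c \<and>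
      \<L> c' w = \<L> c (transition c' c (fst w), jac c' c (fst w) *v snd w)"
    and smooth: "\<And>c. c \<in> atlas \<Longrightarrow> smooth_on (\<Gamma> c) (chart_img c)"
    and sym: "\<And>c x. c \<in> atlas \<Longrightarrow> x \<in> chart_img c \<Longrightarrow> symmetric_symbols (\<Gamma> c x)"
    and compat: "\<And>c x. c \<in> atlas \<Longrightarrow> x \<in> chart_img c \<Longrightarrow> compatible_over (S c) (\<L> c) x (\<Gamma> c x)"
  shows "affine_connection atlas \<Gamma>"
  unfolding affine_connection_iff
proof (intro conjI ballI smooth)
  fix c c' p
  assume c: "c \<in> atlas" "c' \<in> atlas" and p: "p \<in> overlap c c'"
  let ?V = "coords c' ` overlap c c'" and ?\<phi> = "transition c' c" and ?x = "coords c' p"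
  let ?G = "transform_symbols ?\<phi> (jac c c' (coords c p)) ?x (\<Gamma> c (coords c p))"
  interpret C: finsler_chart "S c" "\<L> c" by (rule chart[OF c(1)])
  interpret C': finsler_chart "S c'" "\<L> c'" by (rule chart[OF c(2)])
  have V: "open ?V" "?x \<in> ?V"
    using open_overlap_img[OF c(2,1)] p by (auto simp: overlap_commute)
  have \<phi>: "smooth_on ?\<phi> ?V"
    using smooth_transition[OF c(2,1)] by (simp add: overlap_commute)
  have img: "coords c p \<in> chart_img c" "?x \<in> chart_img c'"
    using p by (auto simp: overlap_def)
  have \<phi>x: "?\<phi> ?x = coords c p"
    using p c by (simp add: overlap_def transition_coords)
  have "compatible_over (S c') (\<L> c') ?x ?G"
  proof (rule compatible_transform_symbols[OF V \<phi> _ C.diff_L C'.open_S])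
    show "jacobian ?\<phi> (at ?x) ** jac c c' (coords c p) = mat 1"
      using jac_inverse[OF c p] by (simp add: jac_def)
    show "compatible_over (S c) (\<L> c) (?\<phi> ?x) (\<Gamma> c (coords c p))"
      unfolding \<phi>x by (rule compat[OF c(1) img(1)])
  qed (use rel[OF c] in \<open>simp_all add: jac_def\<close>)
  moreover have "symmetric_symbols ?G"
    by (rule symmetric_transform_symbols[OF V \<phi> sym[OF c(1) img(1)]])
  \<comment> \<open>Uniqueness compares Berwald symbols at an actual vector, so the fibre over the
    point must be nonempty.\<close>
  moreover obtain z where "z \<in> S c'" "fst z = ?x"
    using img(2) fst_S[OF c(2)] by (metis imageE)
  ultimately show "\<Gamma> c' ?x = ?G"
    using C'.compatible_unique[of z "\<Gamma> c' ?x" ?G] sym[OF c(2) img(2)] compat[OF c(2) img(2)] by simp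
qed

lemma metric_chart:
  assumes "pseudo_riemannian_metric atlas a" "c \<in> atlas"
  shows "metric_chart (chart_img c) a c"
  using assms open_chart_img by unfold_locales (auto simp: pseudo_riemannian_metric_def)

text \<open>No Christoffel symbols are transformed by hand: the quadratic form is a single function
  on tangent vectors, so its invariance under coordinate changes is all that has to be
  computed.\<close>

lemma affine_connection_levi_civita:
  assumes a: "pseudo_riemannian_metric atlas a"
  shows "affine_connection atlas (levi_civita a)"
proof (rule compatible_imp_affine_connection)
  fix c c' and w :: "(real^'n) \<times> (real^'n)"
  assume c: "c \<in> atlas" "c' \<in> atlas" and w: "fst w \<in> coords c' ` overlap c c'"
  obtain p where p: "p \<in> overlap c c'" "fst w = coords c' p" using w by auto
  let ?J = "jac c' c (coords c' p)" and ?b = "a c (coords c p)" and ?y = "snd w"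
  have t: "transition c' c (fst w) = coords c p"
    using p c by (simp add: overlap_def transition_coords)
  have a': "a c' (coords c' p) $ r $ s = (\<Sum>i\<in>UNIV. \<Sum>j\<in>UNIV. ?b $ i $ j * ?J $ i $ r * ?J $ j $ s)" for r s
    using a c p unfolding pseudo_riemannian_metric_def by blast
  have "quad_form (a c' (fst w)) ?y =
      (\<Sum>r\<in>UNIV. \<Sum>s\<in>UNIV. \<Sum>i\<in>UNIV. \<Sum>j\<in>UNIV. ?b $ i $ j * (?J $ i $ r * ?y $ r) * (?J $ j $ s * ?y $ s))"
    by (simp add: quad_form_def p(2) a' sum_distrib_left sum_distrib_right mult_ac)
  also have "\<dots> = (\<Sum>i\<in>UNIV. \<Sum>j\<in>UNIV. \<Sum>r\<in>UNIV. \<Sum>s\<in>UNIV. ?b $ i $ j * (?J $ i $ r * ?y $ r) * (?J $ j $ s * ?y $ s))"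
  proof -
    have "(\<Sum>r\<in>UNIV. \<Sum>s\<in>UNIV. \<Sum>i\<in>UNIV. \<Sum>j\<in>UNIV. f i j r s) =
        (\<Sum>i\<in>UNIV. \<Sum>j\<in>UNIV. \<Sum>r\<in>UNIV. \<Sum>s\<in>UNIV. f i j r s)"
      for f :: "'n \<Rightarrow> 'n \<Rightarrow> 'n \<Rightarrow> 'n \<Rightarrow> real"
    proof -
      have "(\<Sum>r\<in>UNIV. \<Sum>s\<in>UNIV. \<Sum>i\<in>UNIV. \<Sum>j\<in>UNIV. f i j r s) =
          (\<Sum>r\<in>UNIV. \<Sum>i\<in>UNIV. \<Sum>j\<in>UNIV. \<Sum>s\<in>UNIV. f i j r s)"
        by (rule sum.cong[OF refl], subst sum.swap, rule sum.cong[OF refl], rule sum.swap)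
      also have "\<dots> = (\<Sum>i\<in>UNIV. \<Sum>j\<in>UNIV. \<Sum>r\<in>UNIV. \<Sum>s\<in>UNIV. f i j r s)"
        by (subst sum.swap, rule sum.cong[OF refl], rule sum.swap)
      finally show ?thesis .
    qed
    then show ?thesis .
  qed
  also have "\<dots> = quad_form ?b (?J *v ?y)"
    by (simp add: quad_form_def matrix_vector_mult_def sum_distrib_left sum_distrib_right mult_ac)
  finally show "(transition c' c (fst w), jac c' c (fst w) *v snd w) \<in> chart_img c \<times> UNIV \<and>
      quad_form (a c' (fst w)) (snd w) =
      (\<lambda>z. quad_form (a c (fst z)) (snd z)) (transition c' c (fst w), jac c' c (fst w) *v snd w)"
    using p t by (auto simp: overlap_def)
next
  fix c assume c: "c \<in> atlas"
  interpret metric_chart "chart_img c" a c by (rule metric_chart[OF a c])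
  show "finsler_chart (chart_img c \<times> UNIV) (\<lambda>z. quad_form (a c (fst z)) (snd z))"
    by (rule finsler_chart_A)
  show "smooth_on (levi_civita a c) (chart_img c)" by (rule smooth_levi_civita)
  show "fst ` (chart_img c \<times> (UNIV :: (real^'n) set)) = chart_img c" by auto
  fix x assume x: "x \<in> chart_img c"
  show "symmetric_symbols (levi_civita a c x)" by (rule symmetric_levi_civita[OF x])
  show "compatible_over (chart_img c \<times> UNIV) (\<lambda>z. quad_form (a c (fst z)) (snd z)) x (levi_civita a c x)"
    by (rule compatible_levi_civita[OF x])
qed

end

text \<open>The inhomogeneous term of the transformation law does not involve the connection and
  cancels in the difference.\<close>

lemma tensor_diff_affine_connection:
  assumes \<Gamma>: "affine_connection atlas \<Gamma>" and \<Gamma>': "affine_connection atlas \<Gamma>'"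
    and op: "\<And>c. c \<in> atlas \<Longrightarrow> open (chart_img c)"
  shows "smooth_tensor_1_2 atlas (\<lambda>c x. \<Gamma> c x - \<Gamma>' c x)"
  unfolding smooth_tensor_1_2_def
proof (intro conjI ballI allI)
  fix c assume "c \<in> atlas"
  then show "smooth_on (\<lambda>x. \<Gamma> c x - \<Gamma>' c x) (chart_img c)"
    using \<Gamma> \<Gamma>' op by (simp add: affine_connection_def smooth_on_nth3 smooth_on_diff)
next
  fix c c' p r s t
  assume "c \<in> atlas" "c' \<in> atlas" "p \<in> overlap c c'"
  then show "(\<Gamma> c' (coords c' p) - \<Gamma>' c' (coords c' p)) $ r $ s $ t = (\<Sum>j\<in>UNIV. \<Sum>i\<in>UNIV. \<Sum>k\<in>UNIV.
      jac c c' (coords c p) $ r $ j * (\<Gamma> c (coords c p) - \<Gamma>' c (coords c p)) $ j $ i $ k *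
      jac c' c (coords c' p) $ i $ s * jac c' c (coords c' p) $ k $ t)"
    using \<Gamma> \<Gamma>' by (simp add: affine_connection_def algebra_simps sum_subtractf)
qed

lemma affine_connection_add_tensor:
  assumes \<Gamma>: "affine_connection atlas \<Gamma>" and T: "smooth_tensor_1_2 atlas T"
    and op: "\<And>c. c \<in> atlas \<Longrightarrow> open (chart_img c)"
  shows "affine_connection atlas (\<lambda>c x. \<Gamma> c x + T c x)"
  unfolding affine_connection_def
proof (intro conjI ballI allI)
  fix c assume "c \<in> atlas"
  then show "smooth_on (\<lambda>x. \<Gamma> c x + T c x) (chart_img c)"
    using \<Gamma> T op by (simp add: affine_connection_def smooth_tensor_1_2_def smooth_on_add)
next
  fix c c' p r s t
  assume "c \<in> atlas" "c' \<in> atlas" "p \<in> overlap c c'"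
  then show "(\<Gamma> c' (coords c' p) + T c' (coords c' p)) $ r $ s $ t = (\<Sum>j\<in>UNIV. \<Sum>i\<in>UNIV. \<Sum>k\<in>UNIV.
      jac c c' (coords c p) $ r $ j * (\<Gamma> c (coords c p) + T c (coords c p)) $ j $ i $ k *
      jac c' c (coords c' p) $ i $ s * jac c' c (coords c' p) $ k $ t) +
      (\<Sum>j\<in>UNIV. jac c c' (coords c p) $ r $ j *
         partial s (partial t (\<lambda>x'. transition c' c x' $ j)) (coords c' p))"
    using \<Gamma> T by (simp add: affine_connection_def smooth_tensor_1_2_def algebra_simps sum.distrib)
qed

lemma lower_symmetric_iff:
  "lower_symmetric atlas T \<longleftrightarrow> (\<forall>c\<in>atlas. \<forall>x\<in>chart_img c. symmetric_symbols (T c x))"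
  by (simp add: lower_symmetric_def symmetric_symbols_def)

section \<open>Finsler spaces: from charts to the manifold\<close>

locale finsler_manifold = smooth_atlas X atlas
  for X :: "'m topology" and atlas :: "('m, 'n::finite) chart set" +
  fixes \<A> :: "('m, 'n) tvec set" and L :: "('m, 'n) tvec \<Rightarrow> real"
  assumes conic: "conic_subbundle X atlas \<A>" and lagrangian: "finsler_lagrangian atlas \<A> L"
begin

abbreviation \<L> where "\<L> c \<equiv> local_rep atlas c L"

lemma \<A>_subset: "\<A> \<subseteq> tangent_bundle atlas"
  using conic by (simp add: conic_subbundle_def topen_def)

lemma open_local_set: "c \<in> atlas \<Longrightarrow> open (local_set \<A> c)"
  using conic by (simp add: conic_subbundle_def topen_def)

text \<open>The condition that the cone projects onto the whole manifold gives every coordinate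
  point a nonempty fibre, on which symbols can be read off.\<close>

lemma fst_local_set:
  assumes c: "c \<in> atlas"
  shows "fst ` local_set \<A> c = chart_img c"
proof -
  have "chart_dom c \<subseteq> fst ` \<A>"
    using topspace_chart[OF c] conic by (auto simp: conic_subbundle_def)
  then have "fst ` over \<A> c = chart_dom c"
    by (force simp: over_def)
  moreover have "fst ` local_set \<A> c = coords c ` fst ` over \<A> c"
    by (simp add: local_set_def image_image tcoords_def)
  ultimately show ?thesis by simp
qed

lemma finsler_chart_local:
  assumes c: "c \<in> atlas"
  shows "finsler_chart (local_set \<A> c) (\<L> c)"
proof
  show "open (local_set \<A> c)" by (rule open_local_set[OF c])
  show "smooth_on (\<L> c) (local_set \<A> c)"
    using lagrangian c by (simp add: finsler_lagrangian_def tsmooth_on_def)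
  show "invertible (fundamental_tensor (\<L> c) z)" if "z \<in> local_set \<A> c" for z
    using lagrangian c that by (simp add: finsler_lagrangian_def)
  fix z and t :: real
  assume z: "z \<in> local_set \<A> c" and t: "t > 0"
  obtain \<xi> where \<xi>: "\<xi> \<in> over \<A> c" "z = tcoords c \<xi>" using z by (auto simp: local_set_def)
  have s: "tscale t \<xi> \<in> over \<A> c"
    using \<xi> t conic by (auto simp: over_def conic_subbundle_def tscale_def)
  have eq: "(fst z, t *\<^sub>R snd z) = tcoords c (tscale t \<xi>)"
    by (simp add: \<xi> tcoords_def tscale_def)
  show "(fst z, t *\<^sub>R snd z) \<in> local_set \<A> c"
    using s by (simp add: eq local_set_def)
  show "\<L> c (fst z, t *\<^sub>R snd z) = t\<^sup>2 * \<L> c z"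
    unfolding eq unfolding \<xi>(2) using s \<xi>(1) t lagrangian
    by (simp add: local_rep_tcoords[OF c \<A>_subset] finsler_lagrangian_def over_def)
qed

lemma compatible_iff:
  "compatible atlas \<A> L \<Gamma> \<longleftrightarrow>
    (\<forall>c\<in>atlas. \<forall>x\<in>chart_img c. compatible_over (local_set \<A> c) (\<L> c) x (\<Gamma> c x))"
proof -
  have "compatible_over (local_set \<A> c) (\<L> c) x (\<Gamma> c x) \<longleftrightarrow>
      (\<forall>z\<in>local_set \<A> c. fst z = x \<longrightarrow> (\<forall>i. horizontal_deriv (linear_N (\<Gamma> c)) i (\<L> c) z = 0))" for c x
    by (auto simp: compatible_over_def horizontal_deriv_def linear_N_def)
  moreover have "fst z \<in> chart_img c" if "c \<in> atlas" "z \<in> local_set \<A> c" for c z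
    using fst_local_set[OF that(1)] that(2) by blast
  ultimately show ?thesis
    unfolding compatible_def by (smt (verit))
qed

lemma affine_connection_compatible:
  assumes "\<And>c. c \<in> atlas \<Longrightarrow> smooth_on (\<Gamma> c) (chart_img c)"
    and "lower_symmetric atlas \<Gamma>" "compatible atlas \<A> L \<Gamma>"
  shows "affine_connection atlas \<Gamma>"
proof (rule compatible_imp_affine_connection[of "local_set \<A>" \<L>])
  fix c c' w
  assume "c \<in> atlas" "c' \<in> atlas" "w \<in> local_set \<A> c'" "fst w \<in> coords c' ` overlap c c'"
  then show "(transition c' c (fst w), jac c' c (fst w) *v snd w) \<in> local_set \<A> c \<and>
      \<L> c' w = \<L> c (transition c' c (fst w), jac c' c (fst w) *v snd w)"
    using local_rep_transition[OF _ _ \<A>_subset] by blast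
qed (simp_all add: finsler_chart_local fst_local_set assms(1)
    assms(2)[unfolded lower_symmetric_iff, rule_format] assms(3)[unfolded compatible_iff, rule_format])

lemma deformation_equation_iff_compatible:
  assumes a: "pseudo_riemannian_metric atlas a"
    and \<Omega>: "tsmooth_on atlas \<A> \<Omega>"
    and L: "\<And>c \<xi>. c \<in> atlas \<Longrightarrow> \<xi> \<in> over \<A> c \<Longrightarrow>
      L \<xi> = \<Omega> \<xi> * quad_form (a c (coords c (fst \<xi>))) (snd \<xi> c)"
  shows "deformation_equation atlas \<A> L \<Omega> a T \<longleftrightarrow>
    compatible atlas \<A> L (\<lambda>c x. levi_civita a c x + T c x)"
proof -
  have *: "quad_form (a c (fst z)) (snd z) *
        horizontal_deriv (linear_N (levi_civita a c)) i (local_rep atlas c \<Omega>) z =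
      (\<Sum>j\<in>UNIV. \<Sum>k\<in>UNIV. T c (fst z) $ j $ i $ k * snd z $ k * partial_y j (\<L> c) z) \<longleftrightarrow>
      horizontal_deriv (linear_N (\<lambda>x. levi_civita a c x + T c x)) i (\<L> c) z = 0"
    if c: "c \<in> atlas" and z: "z \<in> local_set \<A> c" for c z i
  proof -
    interpret metric_chart "chart_img c" a c by (rule metric_chart[OF a c])
    have "\<L> c w = local_rep atlas c \<Omega> w * A w" if w: "w \<in> local_set \<A> c" for w
    proof -
      obtain \<xi> where \<xi>: "\<xi> \<in> over \<A> c" "w = tcoords c \<xi>" using w by (auto simp: local_set_def)
      show ?thesis
        unfolding \<xi>(2) local_rep_tcoords[OF c \<A>_subset \<xi>(1)]
        using L[OF c \<xi>(1)] by (simp add: tcoords_def)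
    qed
    moreover have "local_rep atlas c \<Omega> differentiable (at z)"
      using \<Omega> c z smooth_on_differentiable unfolding tsmooth_on_def by blast
    moreover have "fst z \<in> chart_img c" using fst_local_set[OF c] z by blast
    ultimately show ?thesis
      using deformation_iff_compatible[OF z _ open_local_set[OF c], of "\<L> c" "local_rep atlas c \<Omega>" i "T c (fst z)"]
      by (simp add: horizontal_deriv_def linear_N_def)
  qed
  then show ?thesis
    unfolding deformation_equation_def compatible_def by blast
qed

lemma compatible_imp_canonical_N:
  assumes "lower_symmetric atlas \<Gamma>" "compatible atlas \<A> L \<Gamma>" and c: "c \<in> atlas" and z: "z \<in> local_set \<A> c"
  shows "canonical_N (\<L> c) k i z = (\<Sum>j\<in>UNIV. \<Gamma> c (fst z) $ k $ i $ j * snd z $ j)"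
    and "berwald_symbol (\<L> c) k i j z = \<Gamma> c (fst z) $ k $ i $ j"
    and "chern_rund (\<L> c) k i j z = \<Gamma> c (fst z) $ k $ i $ j"
proof -
  interpret finsler_chart "local_set \<A> c" "\<L> c" by (rule finsler_chart_local[OF c])
  have "fst z \<in> chart_img c" using fst_local_set[OF c] z by blast
  then have s: "symmetric_symbols (\<Gamma> c (fst z))"
      "compatible_over (local_set \<A> c) (\<L> c) (fst z) (\<Gamma> c (fst z))"
    using assms by (auto simp: lower_symmetric_iff compatible_iff)
  show "canonical_N (\<L> c) k i z = (\<Sum>j\<in>UNIV. \<Gamma> c (fst z) $ k $ i $ j * snd z $ j)"
    by (rule canonical_N_compatible[OF z s z refl])
  show "berwald_symbol (\<L> c) k i j z = \<Gamma> c (fst z) $ k $ i $ j"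
    by (rule berwald_symbol_compatible[OF z s])
  show "chern_rund (\<L> c) k i j z = \<Gamma> c (fst z) $ k $ i $ j"
    by (rule chern_rund_compatible[OF z s])
qed

lemma berwald_type_iff:
  "berwald_type atlas \<A> L \<longleftrightarrow>
    (\<exists>\<Gamma>. torsion_free_affine_connection atlas \<Gamma> \<and> compatible atlas \<A> L \<Gamma>)"
proof
  assume "berwald_type atlas \<A> L"
  \<comment> \<open>The arrays are picked independently in each chart. Their agreement on overlaps
    follows at the end from \<open>affine_connection_compatible\<close>.\<close>
  then obtain \<Gamma> where \<Gamma>: "\<And>c z k i. c \<in> atlas \<Longrightarrow> z \<in> local_set \<A> c \<Longrightarrow>
      canonical_N (\<L> c) k i z = (\<Sum>j\<in>UNIV. \<Gamma> c (fst z) $ k $ i $ j * snd z $ j)"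
    unfolding berwald_type_def by metis
  have sc: "symmetric_symbols (\<Gamma> c x)" "compatible_over (local_set \<A> c) (\<L> c) x (\<Gamma> c x)"
    if c: "c \<in> atlas" and x: "x \<in> chart_img c" for c x
  proof -
    interpret finsler_chart "local_set \<A> c" "\<L> c" by (rule finsler_chart_local[OF c])
    obtain z where z: "z \<in> local_set \<A> c" "fst z = x"
      using x fst_local_set[OF c] by (metis imageE)
    show "symmetric_symbols (\<Gamma> c x)"
      by (rule berwald_imp_symmetric_compatible(1)[OF z(1)]) (simp add: \<Gamma>[OF c] z)
    show "compatible_over (local_set \<A> c) (\<L> c) x (\<Gamma> c x)"
      using berwald_imp_symmetric_compatible(2)[OF z(1), of "\<Gamma> c x"] \<Gamma>[OF c] z by simp
  qed
  have "lower_symmetric atlas \<Gamma>" "compatible atlas \<A> L \<Gamma>"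
    using sc by (simp_all add: lower_symmetric_iff compatible_iff)
  moreover have "smooth_on (\<Gamma> c) (chart_img c)" if c: "c \<in> atlas" for c
    using finsler_chart.smooth_berwald_connection[OF finsler_chart_local[OF c] \<Gamma>[OF c]]
    by (simp add: fst_local_set[OF c])
  ultimately show "\<exists>\<Gamma>. torsion_free_affine_connection atlas \<Gamma> \<and> compatible atlas \<A> L \<Gamma>"
    unfolding torsion_free_affine_connection_def using affine_connection_compatible by blast
next
  assume "\<exists>\<Gamma>. torsion_free_affine_connection atlas \<Gamma> \<and> compatible atlas \<A> L \<Gamma>"
  then show "berwald_type atlas \<A> L"
    unfolding torsion_free_affine_connection_def berwald_type_def
    using compatible_imp_canonical_N(1) by blast
qed

lemma compatible_connection_unique:
  assumes "lower_symmetric atlas \<Gamma>" "compatible atlas \<A> L \<Gamma>"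
    and "lower_symmetric atlas \<Gamma>'" "compatible atlas \<A> L \<Gamma>'"
    and c: "c \<in> atlas" and x: "x \<in> chart_img c"
  shows "\<Gamma>' c x = \<Gamma> c x"
proof -
  obtain z where z: "z \<in> local_set \<A> c" "fst z = x"
    using x fst_local_set[OF c] by (metis imageE)
  show ?thesis
    using compatible_imp_canonical_N(2)[OF assms(1,2) c z(1)]
      compatible_imp_canonical_N(2)[OF assms(3,4) c z(1)] z(2)
    by (simp add: vec_eq_iff)
qed

end

theorem theorem5p1p1:
  fixes X :: "'m topology"
    and atlas :: "('m, 'n::finite) chart set"
    and \<A> :: "('m, 'n) tvec set"
    and L \<Omega> :: "('m, 'n) tvec \<Rightarrow> real"
    and a :: "('m, 'n) field2"
  assumes finsler: "finsler_space X atlas \<A> L"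
    and metric: "pseudo_riemannian_metric atlas a"
    and Omega_smooth: "tsmooth_on atlas \<A> \<Omega>"
    and factorization: "\<And>c \<xi>. c \<in> atlas \<Longrightarrow> \<xi> \<in> over \<A> c \<Longrightarrow>
          L \<xi> = \<Omega> \<xi> * quad_form (a c (coords c (fst \<xi>))) (snd \<xi> c)"
  shows "(berwald_type atlas \<A> L \<longleftrightarrow>
       (\<exists>T. smooth_tensor_1_2 atlas T \<and> lower_symmetric atlas T \<and>
            deformation_equation atlas \<A> L \<Omega> a T)) \<and>
    (\<forall>T. smooth_tensor_1_2 atlas T \<and> lower_symmetric atlas T \<and>
         deformation_equation atlas \<A> L \<Omega> a T \<longrightarrow>
       (let \<Gamma> = (\<lambda>c x. levi_civita a c x + T c x) in
          torsion_free_affine_connection atlas \<Gamma> \<and> compatible atlas \<A> L \<Gamma> \<and>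
          (\<forall>\<Gamma>'. torsion_free_affine_connection atlas \<Gamma>' \<and> compatible atlas \<A> L \<Gamma>' \<longrightarrow>
             (\<forall>c\<in>atlas. \<forall>x\<in>chart_img c. \<Gamma>' c x = \<Gamma> c x)) \<and>
          (\<forall>c\<in>atlas. \<forall>z\<in>local_set \<A> c. \<forall>k i j.
             \<Gamma> c (fst z) $ k $ i $ j = chern_rund (local_rep atlas c L) k i j z \<and>
             \<Gamma> c (fst z) $ k $ i $ j = berwald_symbol (local_rep atlas c L) k i j z)))"
proof -
  interpret finsler_manifold X atlas \<A> L
    using finsler by unfold_locales (auto simp: finsler_space_def)
  note deformation = deformation_equation_iff_compatible[OF metric Omega_smooth factorization]
  have lc: "affine_connection atlas (levi_civita a)"
    by (rule affine_connection_levi_civita[OF metric])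
  have lc_sym: "lower_symmetric atlas (levi_civita a)"
    using metric_chart.symmetric_levi_civita[OF metric_chart[OF metric]]
    by (simp add: lower_symmetric_iff)
  have sum: "torsion_free_affine_connection atlas (\<lambda>c x. levi_civita a c x + T c x)"
    if "smooth_tensor_1_2 atlas T" "lower_symmetric atlas T" for T
    using affine_connection_add_tensor[OF lc that(1) open_chart_img] lc_sym that(2)
    by (simp add: torsion_free_affine_connection_def lower_symmetric_def)
  have diff: "\<exists>T. smooth_tensor_1_2 atlas T \<and> lower_symmetric atlas T \<and>
      deformation_equation atlas \<A> L \<Omega> a T"
    if "torsion_free_affine_connection atlas \<Gamma>" "compatible atlas \<A> L \<Gamma>" for \<Gamma>
  proof (intro exI conjI)
    \<comment> \<open>The difference of two torsion-free connections is a symmetric tensor, and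
      adding Levi-Civita back returns \<Gamma>, whose compatibility is given.\<close>
    let ?T = "\<lambda>c x. \<Gamma> c x - levi_civita a c x"
    have \<Gamma>: "affine_connection atlas \<Gamma>" "lower_symmetric atlas \<Gamma>"
      using that(1) by (auto simp: torsion_free_affine_connection_def)
    show "smooth_tensor_1_2 atlas ?T"
      by (rule tensor_diff_affine_connection[OF \<Gamma>(1) lc open_chart_img])
    show "lower_symmetric atlas ?T"
      using \<Gamma>(2) lc_sym by (simp add: lower_symmetric_def)
    show "deformation_equation atlas \<A> L \<Omega> a ?T"
      using that(2) by (simp add: deformation)
  qed
  show ?thesis
    unfolding berwald_type_iff Let_def
  proof (intro conjI allI impI iffI)
    fix T assume T: "smooth_tensor_1_2 atlas T \<and> lower_symmetric atlas T \<and>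
      deformation_equation atlas \<A> L \<Omega> a T"
    let ?\<Gamma> = "\<lambda>c x. levi_civita a c x + T c x"
    show tf: "torsion_free_affine_connection atlas ?\<Gamma>" using T sum by blast
    show co: "compatible atlas \<A> L ?\<Gamma>" using T deformation by blast
    have sy: "lower_symmetric atlas ?\<Gamma>"
      using tf by (simp add: torsion_free_affine_connection_def)
    show "\<forall>c\<in>atlas. \<forall>x\<in>chart_img c. \<Gamma>' c x = ?\<Gamma> c x"
      if "torsion_free_affine_connection atlas \<Gamma>' \<and> compatible atlas \<A> L \<Gamma>'" for \<Gamma>'
      using that compatible_connection_unique[OF sy co]
      unfolding torsion_free_affine_connection_def by blast
    show "\<forall>c\<in>atlas. \<forall>z\<in>local_set \<A> c. \<forall>k i j.
        ?\<Gamma> c (fst z) $ k $ i $ j = chern_rund (\<L> c) k i j z \<and>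
        ?\<Gamma> c (fst z) $ k $ i $ j = berwald_symbol (\<L> c) k i j z"
      using compatible_imp_canonical_N(2,3)[OF sy co] by simp
  qed (use sum deformation diff in blast)+
qed

end
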